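(* Let $(M,m)$ be a compact weighted Riemannian manifold with (non-empty) boundary and let $k\ge1$ be an integer. For any sequence $\{A_\alpha\}_{\alpha=1}^{k}$ of Borel subsets of $M$, we have $$\mathcal{I}^{D}_k(M,m)\le\frac{2}{\mathcal{D}^{\partial}(\{A_\alpha\})}\max_{\alpha=1,\dots,k}\log\frac{e\left(1-\sum_{\beta\ne\alpha}m(A_\beta)\right)}{m(A_\alpha)}.$$
   Context: A compact weighted Riemannian manifold with boundary $(M,m)$ is a connected compact Riemannian manifold $(M,g)$ with non-empty boundary $\partial M$ and interior $\mathrm{Int}\,M$, with Riemannian distance $d$ and Riemannian volume measure $v_g$, together with the probability measure $m=e^{-f}v_g$, where $f\in C^\infty(M)$ satisfies $\int_M e^{-f}\,dv_g=1$. For a Borel set $A\subset M$ put $m^+(A):=\liminf_{r\to0^+}\frac{m(U_r(A))-m(A)}{r}$, where $U_r(A)$ is the open $r$-neighborhood of $A$ in $M$. The $k$-way Dirichlet isoperimetric constant is $$\mathcal{I}^{D}_k(M,m):=\inf_{\{A_\alpha\}}\max_{\alpha=1,\dots,k}\frac{m^+(A_\alpha)}{m(A_\alpha)},$$ where the infimum is over all pairwise disjoint sequences $\{A_\alpha\}_{\alpha=1}^{k}$ of non-empty Borel subsets $A_\alpha\subset\mathrm{Int}\,M$ (of positive $m$-measure, so that the quotients make sense). $\mathcal{D}^{\partial}(\{A_\alpha\}):=\min\{\min_{\alpha\ne\beta}d(A_\alpha,A_\beta),\ \min_\alpha d(A_\alpha,\partial M)\}$, where $d(A,B):=\inf\{d(x,y)\mid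 x\in A,\ y\in B\}$ (a minimum over an empty index set is ignored). Convention: if $\mathcal{D}^{\partial}(\{A_\alpha\})=0$ or $m(A_\alpha)=0$ for some $\alpha$, the right-hand side is understood as $+\infty$. $\log$ is the natural logarithm. *)

theory Defs
  imports "HOL-Analysis.Analysis"
begin

section \<open>Smooth maps\<close>

primrec Ck_on :: "nat \<Rightarrow> 'v::real_normed_vector set \<Rightarrow> ('v \<Rightarrow> 'w::real_normed_vector) \<Rightarrow> bool" where
  "Ck_on 0 W F \<longleftrightarrow> continuous_on W F"
| "Ck_on (Suc k) W F \<longleftrightarrow>
     (\<forall>x\<in>W. F differentiable (at x)) \<and> (\<forall>v. Ck_on k W (\<lambda>x. frechet_derivative F (at x) v))"

text \<open>On a set that need not be open (such as a relatively open subset of a half-space), a map is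
  smooth if it extends, near every point of the set, to a smooth map on an open set.\<close>

definition smooth_on :: "'v::real_normed_vector set \<Rightarrow> ('v \<Rightarrow> 'w::real_normed_vector) \<Rightarrow> bool" where
  "smooth_on S F \<longleftrightarrow>
     (\<forall>x\<in>S. \<exists>W G. open W \<and> x \<in> W \<and> (\<forall>k. Ck_on k W G) \<and> (\<forall>y\<in>S \<inter> W. G y = F y))"


section \<open>Smooth manifolds with boundary\<close>

text \<open>The manifold is the space of an abstract topology, its dimension is \<open>CARD('n)\<close>, and a chart
  is a pair of a domain and a coordinate map into the model half-space. Which coordinate cuts out
  the half-space is immaterial.\<close>

type_synonym ('a, 'n) chart = "'a set \<times> ('a \<Rightarrow> real ^ 'n)"

definition bdry_coord :: "'n::finite" where
  "bdry_coord = (SOME i. True)"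

definition half_space :: "(real ^ 'n::finite) set" where
  "half_space = {x. 0 \<le> x $ bdry_coord}"

definition is_chart :: "'a topology \<Rightarrow> ('a, 'n::finite) chart \<Rightarrow> bool" where
  "is_chart X c \<longleftrightarrow>
     openin X (fst c) \<and>
     openin (top_of_set half_space) (snd c ` fst c) \<and>
     homeomorphic_map (subtopology X (fst c)) (top_of_set (snd c ` fst c)) (snd c)"

definition chart_inv :: "('a, 'n::finite) chart \<Rightarrow> real ^ 'n \<Rightarrow> 'a" where
  "chart_inv c = inv_into (fst c) (snd c)"

definition overlap :: "('a, 'n::finite) chart \<Rightarrow> ('a, 'n) chart \<Rightarrow> (real ^ 'n) set" where
  "overlap c c' = snd c ` (fst c \<inter> fst c')"

definition transition :: "('a, 'n::finite) chart \<Rightarrow> ('a, 'n) chart \<Rightarrow> real ^ 'n \<Rightarrow> real ^ 'n" where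
  "transition c c' = snd c' \<circ> chart_inv c"

definition smooth_atlas :: "'a topology \<Rightarrow> ('a, 'n::finite) chart set \<Rightarrow> bool" where
  "smooth_atlas X \<A> \<longleftrightarrow>
     (\<forall>c\<in>\<A>. is_chart X c) \<and>
     (\<Union>c\<in>\<A>. fst c) = topspace X \<and>
     (\<forall>c\<in>\<A>. \<forall>c'\<in>\<A>. smooth_on (overlap c c') (transition c c'))"

definition manifold_boundary :: "('a, 'n::finite) chart set \<Rightarrow> 'a set" where
  "manifold_boundary \<A> = {p. \<exists>c\<in>\<A>. p \<in> fst c \<and> snd c p $ bdry_coord = 0}"

definition manifold_interior :: "'a topology \<Rightarrow> ('a, 'n::finite) chart set \<Rightarrow> 'a set" where
  "manifold_interior X \<A> = topspace X - manifold_boundary \<A>"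

definition smooth_function :: "('a, 'n::finite) chart set \<Rightarrow> ('a \<Rightarrow> real) \<Rightarrow> bool" where
  "smooth_function \<A> f \<longleftrightarrow> (\<forall>c\<in>\<A>. smooth_on (snd c ` fst c) (f \<circ> chart_inv c))"


section \<open>Riemannian metrics, distance and volume\<close>

text \<open>A Riemannian metric is given by its components: \<open>g c p\<close> is the Gram matrix
  \<open>(g\<^sub>i\<^sub>j)\<close> at the point \<open>p\<close> of the coordinate frame of the chart \<open>c\<close>. The last condition is the
  transformation law of a covariant 2-tensor. The derivative is taken within the overlap because
  of boundary points; it is unique since the overlap is relatively open in the half-space.\<close>

type_synonym ('a, 'n) metric_components = "('a, 'n) chart \<Rightarrow> 'a \<Rightarrow> real ^ 'n ^ 'n"

definition riemannian_metric ::
    "('a, 'n::finite) chart set \<Rightarrow> ('a, 'n) metric_components \<Rightarrow> bool" where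
  "riemannian_metric \<A> g \<longleftrightarrow>
     (\<forall>c\<in>\<A>. smooth_on (snd c ` fst c) (\<lambda>x. g c (chart_inv c x))) \<and>
     (\<forall>c\<in>\<A>. \<forall>p\<in>fst c. transpose (g c p) = g c p \<and> (\<forall>v. v \<noteq> 0 \<longrightarrow> 0 < v \<bullet> (g c p *v v))) \<and>
     (\<forall>c\<in>\<A>. \<forall>c'\<in>\<A>. \<forall>p\<in>fst c \<inter> fst c'.
        let D = frechet_derivative (transition c c') (at (snd c p) within overlap c c')
        in \<forall>v w. v \<bullet> (g c p *v w) = D v \<bullet> (g c' p *v D w))"

text \<open>By the transformation law, the speed does not depend on the chosen chart.\<close>

definition speed :: "('a, 'n::finite) chart set \<Rightarrow> ('a, 'n) metric_components \<Rightarrow>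
    (real \<Rightarrow> 'a) \<Rightarrow> real \<Rightarrow> real" where
  "speed \<A> g \<gamma> t =
     (let c = (SOME c. c \<in> \<A> \<and> \<gamma> t \<in> fst c);
          v = vector_derivative (snd c \<circ> \<gamma>) (at t)
      in sqrt (v \<bullet> (g c (\<gamma> t) *v v)))"

text \<open>As in the library's notion of a valid path, a piecewise \<open>C\<^sup>1\<close> curve is a continuous curve that
  is \<open>C\<^sup>1\<close> off a finite set of parameters. Nothing is required of the derivative near the
  exceptional parameters; this does not change the infimum of lengths.\<close>

definition piecewise_C1_curve ::
    "'a topology \<Rightarrow> ('a, 'n::finite) chart set \<Rightarrow> (real \<Rightarrow> 'a) \<Rightarrow> bool" where
  "piecewise_C1_curve X \<A> \<gamma> \<longleftrightarrow>
     pathin X \<gamma> \<and>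
     (\<exists>S. finite S \<and>
        (\<forall>c\<in>\<A>. (snd c \<circ> \<gamma>) C1_differentiable_on ({t \<in> {0<..<1}. \<gamma> t \<in> fst c} - S)))"

definition curve_length :: "('a, 'n::finite) chart set \<Rightarrow> ('a, 'n) metric_components \<Rightarrow>
    (real \<Rightarrow> 'a) \<Rightarrow> ennreal" where
  "curve_length \<A> g \<gamma> = (\<integral>\<^sup>+t\<in>{0..1}. ennreal (speed \<A> g \<gamma> t) \<partial>lborel)"

definition riemannian_dist :: "'a topology \<Rightarrow> ('a, 'n::finite) chart set \<Rightarrow>
    ('a, 'n) metric_components \<Rightarrow> 'a \<Rightarrow> 'a \<Rightarrow> ennreal" where
  "riemannian_dist X \<A> g x y =
     Inf {curve_length \<A> g \<gamma> |\<gamma>. piecewise_C1_curve X \<A> \<gamma> \<and> \<gamma> 0 = x \<and> \<gamma> 1 = y}"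

definition set_dist :: "'a topology \<Rightarrow> ('a, 'n::finite) chart set \<Rightarrow>
    ('a, 'n) metric_components \<Rightarrow> 'a set \<Rightarrow> 'a set \<Rightarrow> ennreal" where
  "set_dist X \<A> g A B = (INF x\<in>A. INF y\<in>B. riemannian_dist X \<A> g x y)"

definition open_nbhd :: "'a topology \<Rightarrow> ('a, 'n::finite) chart set \<Rightarrow>
    ('a, 'n) metric_components \<Rightarrow> real \<Rightarrow> 'a set \<Rightarrow> 'a set" where
  "open_nbhd X \<A> g r A = {x \<in> topspace X. \<exists>a\<in>A. riemannian_dist X \<A> g a x < ennreal r}"

definition borel_sets :: "'a topology \<Rightarrow> 'a set set" where
  "borel_sets X = sigma_sets (topspace X) {U. openin X U}"

definition chart_volume ::
    "('a, 'n::finite) metric_components \<Rightarrow> ('a, 'n) chart \<Rightarrow> 'a set \<Rightarrow> ennreal" where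
  "chart_volume g c B =
     (\<integral>\<^sup>+x\<in>snd c ` B. ennreal (sqrt (det (g c (chart_inv c x)))) \<partial>lborel)"

text \<open>The volume of \<open>B\<close> is the total volume of a decomposition of \<open>B\<close> into finitely many disjoint
  Borel pieces, each measured in a chart containing it. Decompositions of subsets of \<open>B\<close> are
  admitted, which turns the value into a supremum; for compact \<open>M\<close> the supremum is attained and
  is the measure that agrees with \<open>chart_volume\<close> inside each chart.\<close>

definition riemannian_volume :: "'a topology \<Rightarrow> ('a, 'n::finite) chart set \<Rightarrow>
    ('a, 'n) metric_components \<Rightarrow> 'a measure" where
  "riemannian_volume X \<A> g =
     measure_of (topspace X) (borel_sets X)
       (\<lambda>B. SUP P\<in>{P. finite P \<and> P \<subseteq> \<A> \<times> borel_sets X \<and>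
                       (\<forall>(c, C)\<in>P. C \<subseteq> fst c \<inter> B) \<and>
                       pairwise (\<lambda>(c, C) (c', C'). disjnt C C') P}.
              \<Sum>(c, C)\<in>P. chart_volume g c C)"


section \<open>Compact weighted Riemannian manifolds with boundary\<close>

locale compact_weighted_riemannian_manifold =
  fixes X :: "'a topology"
    and \<A> :: "('a, 'n::finite) chart set"
    and g :: "('a, 'n) metric_components"
    and f :: "'a \<Rightarrow> real"
  assumes Hausdorff: "Hausdorff_space X"
    and compact: "compact_space X"
    and connected: "connected_space X"
    and atlas: "smooth_atlas X \<A>"
    and boundary_nonempty: "manifold_boundary \<A> \<noteq> {}"
    and metric: "riemannian_metric \<A> g"
    and weight_smooth: "smooth_function \<A> f"
    and weight_normalized: "(\<integral>x. exp (- f x) \<partial>riemannian_volume X \<A> g) = 1"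

definition weighted_measure :: "'a topology \<Rightarrow> ('a, 'n::finite) chart set \<Rightarrow>
    ('a, 'n) metric_components \<Rightarrow> ('a \<Rightarrow> real) \<Rightarrow> 'a measure" where
  "weighted_measure X \<A> g f = density (riemannian_volume X \<A> g) (\<lambda>x. ennreal (exp (- f x)))"


section \<open>Isoperimetric constants\<close>

definition boundary_measure :: "'a topology \<Rightarrow> ('a, 'n::finite) chart set \<Rightarrow>
    ('a, 'n) metric_components \<Rightarrow> ('a \<Rightarrow> real) \<Rightarrow> 'a set \<Rightarrow> ereal" where
  "boundary_measure X \<A> g f A =
     (let m = measure (weighted_measure X \<A> g f)
      in Liminf (at_right 0) (\<lambda>r. ereal ((m (open_nbhd X \<A> g r A) - m A) / r)))"

definition dirichlet_isoperimetric_constant :: "'a topology \<Rightarrow> ('a, 'n::finite) chart set \<Rightarrow>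
    ('a, 'n) metric_components \<Rightarrow> ('a \<Rightarrow> real) \<Rightarrow> nat \<Rightarrow> ereal" where
  "dirichlet_isoperimetric_constant X \<A> g f k =
     (let m = measure (weighted_measure X \<A> g f)
      in INF A\<in>{A :: nat \<Rightarrow> 'a set.
                  (\<forall>\<alpha>\<in>{1..k}. A \<alpha> \<in> borel_sets X \<and> A \<alpha> \<subseteq> manifold_interior X \<A> \<and> 0 < m (A \<alpha>)) \<and>
                  disjoint_family_on A {1..k}}.
           MAX \<alpha>\<in>{1..k}. boundary_measure X \<A> g f (A \<alpha>) / ereal (m (A \<alpha>)))"

text \<open>An infimum over an empty index set is \<open>\<infinity>\<close> in \<open>ennreal\<close>, hence does not contribute.\<close>

definition separation :: "'a topology \<Rightarrow> ('a, 'n::finite) chart set \<Rightarrow>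
    ('a, 'n) metric_components \<Rightarrow> nat \<Rightarrow> (nat \<Rightarrow> 'a set) \<Rightarrow> ennreal" where
  "separation X \<A> g k A =
     min (INF \<alpha>\<in>{1..k}. INF \<beta>\<in>{1..k} - {\<alpha>}. set_dist X \<A> g (A \<alpha>) (A \<beta>))
         (INF \<alpha>\<in>{1..k}. set_dist X \<A> g (A \<alpha>) (manifold_boundary \<A>))"

definition separation_bound :: "'a topology \<Rightarrow> ('a, 'n::finite) chart set \<Rightarrow>
    ('a, 'n) metric_components \<Rightarrow> ('a \<Rightarrow> real) \<Rightarrow> nat \<Rightarrow> (nat \<Rightarrow> 'a set) \<Rightarrow> ereal" where
  "separation_bound X \<A> g f k A =
     (let m = measure (weighted_measure X \<A> g f); D = separation X \<A> g k A
      in if D = 0 \<or> (\<exists>\<alpha>\<in>{1..k}. m (A \<alpha>) = 0) then \<infinity>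
         else ereal (2 / enn2real D *
                (MAX \<alpha>\<in>{1..k}. ln (exp 1 * (1 - (\<Sum>\<beta>\<in>{1..k} - {\<alpha>}. m (A \<beta>))) / m (A \<alpha>)))))"

end

theory Submission
  imports Defs
begin

text \<open>Let \<open>D\<close> be the separation of the sets \<open>A \<alpha>\<close> from each other and from the boundary. For radii
  \<open>r \<alpha> < D/2\<close>, chosen independently of each other, the neighbourhoods \<open>U\<^sub>r(A \<alpha>)\<close> are disjoint and
  contained in the interior, hence they compete in the definition of the isoperimetric constant. It
  remains to find, for each \<open>\<alpha>\<close> separately, a radius for which the quotient of boundary measure
  and volume is small.

  Write \<open>\<phi>(r)\<close> for the volume of \<open>U\<^sub>r(A \<alpha>)\<close>. Since \<open>U\<^sub>s(U\<^sub>r(A)) \<subseteq> U\<^bsub>r+s\<^esub>(A)\<close>, the boundary measure of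
  \<open>U\<^sub>r(A \<alpha>)\<close> is at most the lower right derivative of \<open>\<phi>\<close> at \<open>r\<close>, so the quotient is at most the
  derivative of \<open>ln \<phi>\<close>. Over an interval of length \<open>D/2\<close> the function \<open>ln \<phi>\<close> increases by at most
  \<open>ln ((1 - \<Sum>\<beta> \<noteq> \<alpha>. m (A \<beta>)) / m (A \<alpha>))\<close>, because \<open>U\<^sub>r(A \<alpha>)\<close> avoids the other sets. Thus its
  derivative cannot everywhere exceed that number times \<open>2/D\<close>; this is \<open>slow_growth_point\<close>, in which
  monotonicity of \<open>\<phi>\<close> replaces differentiability. The factor \<open>e\<close> in the logarithm makes the
  comparison strict.

  Two geometric facts enter. The Riemannian distance is a pseudometric (constant, reversed and
  concatenated curves), and nearby points are at small distance (\<open>riemannian_dist_small_nearby\<close>,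
  by means of coordinate segments). From the latter, neighbourhoods are open, hence measurable, and
  the distance is finite because the manifold is connected. Finiteness matters: if \<open>D\<close> were infinite,
  the bound would be 0.\<close>

section \<open>Integrals of functions that need not be measurable\<close>

text \<open>The speed of a curve is computed in a chart picked by choice at every point, so its
  measurability is not immediate. The substitution rule and the splitting of an integral are
  therefore stated as inequalities for arbitrary functions. They hold because the integral is a
  supremum over simple minorants, and the usual rules apply to each minorant.\<close>

lemma nn_integral_affine_le:
  fixes u :: "real \<Rightarrow> ennreal" and b c :: real
  assumes c: "c \<noteq> 0"
  shows "(\<integral>\<^sup>+t. ennreal \<bar>c\<bar> * u (b + c * t) \<partial>lborel) \<le> (\<integral>\<^sup>+t. u t \<partial>lborel)"
  unfolding nn_integral_def[of lborel "\<lambda>t. ennreal \<bar>c\<bar> * u (b + c * t)"]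
proof (rule SUP_least, clarify)
  fix s :: "real \<Rightarrow> ennreal"
  assume s: "simple_function lborel s" and le: "s \<le> (\<lambda>t. ennreal \<bar>c\<bar> * u (b + c * t))"
  have [measurable]: "s \<in> borel_measurable borel"
    using borel_measurable_simple_function[OF s] by simp
  have "integral\<^sup>S lborel s = (\<integral>\<^sup>+t. s t \<partial>lborel)"
    using nn_integral_eq_simple_integral[OF s] by simp
  also have "\<dots> = ennreal \<bar>1 / c\<bar> * (\<integral>\<^sup>+t. s (- b / c + (1 / c) * t) \<partial>lborel)"
    by (rule nn_integral_real_affine) (use c in auto)
  also have "\<dots> = (\<integral>\<^sup>+t. ennreal \<bar>1 / c\<bar> * s (- b / c + (1 / c) * t) \<partial>lborel)"
    by (rule nn_integral_cmult[symmetric]) measurable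
  also have "\<dots> \<le> (\<integral>\<^sup>+t. u t \<partial>lborel)"
  proof (rule nn_integral_mono)
    fix t
    have "s (- b / c + (1 / c) * t) \<le> ennreal \<bar>c\<bar> * u (b + c * (- b / c + (1 / c) * t))"
      using le by (simp add: le_fun_def)
    also have "b + c * (- b / c + (1 / c) * t) = t"
      using c by (simp add: field_simps)
    finally have "ennreal \<bar>1 / c\<bar> * s (- b / c + (1 / c) * t) \<le> ennreal \<bar>1 / c\<bar> * (ennreal \<bar>c\<bar> * u t)"
      by (rule mult_left_mono) simp
    also have "\<dots> = u t"
    proof -
      have "ennreal \<bar>1 / c\<bar> * ennreal \<bar>c\<bar> = 1"
        using c by (subst ennreal_mult'[symmetric]) auto
      then show ?thesis by (metis mult.assoc mult_1)
    qed
    finally show "ennreal \<bar>1 / c\<bar> * s (- b / c + (1 / c) * t) \<le> u t" .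
  qed
  finally show "integral\<^sup>S lborel s \<le> (\<integral>\<^sup>+t. u t \<partial>lborel)" .
qed

lemma nn_integral_split_le:
  assumes B: "B \<in> sets M"
    and u: "\<And>t. t \<in> B \<Longrightarrow> h t \<le> u t" and v: "\<And>t. t \<notin> B \<Longrightarrow> h t \<le> v t"
  shows "(\<integral>\<^sup>+t. h t \<partial>M) \<le> (\<integral>\<^sup>+t. u t \<partial>M) + (\<integral>\<^sup>+t. v t \<partial>M)"
  unfolding nn_integral_def[of M h]
proof (rule SUP_least, clarify)
  fix s assume s: "simple_function M s" and le: "s \<le> h"
  have [measurable]: "s \<in> borel_measurable M" "B \<in> sets M"
    using borel_measurable_simple_function[OF s] B by auto
  have "integral\<^sup>S M s = (\<integral>\<^sup>+t. s t \<partial>M)"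
    using nn_integral_eq_simple_integral[OF s] by simp
  also have "\<dots> = (\<integral>\<^sup>+t. s t * indicator B t + s t * indicator (- B) t \<partial>M)"
    by (intro nn_integral_cong) (auto split: split_indicator)
  also have "\<dots> = (\<integral>\<^sup>+t. s t * indicator B t \<partial>M) + (\<integral>\<^sup>+t. s t * indicator (- B) t \<partial>M)"
    by (rule nn_integral_add) measurable
  also have "\<dots> \<le> (\<integral>\<^sup>+t. u t \<partial>M) + (\<integral>\<^sup>+t. v t \<partial>M)"
    using le u v by (intro add_mono nn_integral_mono)
      (auto simp: le_fun_def split: split_indicator intro: order_trans)
  finally show "integral\<^sup>S M s \<le> (\<integral>\<^sup>+t. u t \<partial>M) + (\<integral>\<^sup>+t. v t \<partial>M)" .
qed

section \<open>Points of slow growth of a monotone function\<close>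

text \<open>If the lower right derivative exceeded \<open>c \<cdot> \<phi>\<close> at every point of \<open>[0, R)\<close>, then \<open>\<phi>\<close> would grow
  at least like \<open>exp (c' r)\<close> for any \<open>c' < c\<close>: the set of radii up to which this lower bound holds
  is closed under suprema because \<open>\<phi>\<close> is monotone, and the derivative pushes it beyond any of its
  points below \<open>R\<close>. At \<open>R\<close> this contradicts the total growth when \<open>c'\<close> lies above the average
  logarithmic growth rate \<open>ln (\<phi> R / \<phi> 0) / R\<close>. The volume of a neighbourhood may jump as its
  radius grows, whence a supremum rather than a differential inequality for \<open>ln \<phi>\<close>.\<close>

lemma slow_growth_point:
  fixes \<phi> :: "real \<Rightarrow> real"
  assumes mono: "\<And>r s. 0 \<le> r \<Longrightarrow> r \<le> s \<Longrightarrow> \<phi> r \<le> \<phi> s"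
    and pos: "0 < \<phi> 0" and R: "0 < R" and c: "ln (\<phi> R / \<phi> 0) / R < c"
  obtains (slow) r where "0 \<le> r" "r < R"
    "Liminf (at_right 0) (\<lambda>s. ereal ((\<phi> (r + s) - \<phi> r) / s)) \<le> ereal (c * \<phi> r)"
proof (rule ccontr)
  assume none: "\<not> thesis"
  have fast: "ereal (c * \<phi> r) < Liminf (at_right 0) (\<lambda>s. ereal ((\<phi> (r + s) - \<phi> r) / s))"
    if "0 \<le> r" "r < R" for r
  proof (rule ccontr)
    assume "\<not> ?thesis"
    then have thesis using slow[OF that] by simp
    with none show False ..
  qed
  obtain c' where c': "ln (\<phi> R / \<phi> 0) / R < c'" "c' < c"
    using dense[OF c] by (elim exE conjE)
  have pos_r: "0 < \<phi> r" if "0 \<le> r" for r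
    using less_le_trans[OF pos mono[OF order_refl that]] .
  have "1 \<le> \<phi> R / \<phi> 0"
    using mono[OF order_refl less_imp_le[OF R]] pos by (subst le_divide_eq_1_pos)
  then have "0 \<le> ln (\<phi> R / \<phi> 0) / R"
    using R by (intro divide_nonneg_pos ln_ge_zero)
  with c'(1) have c'0: "0 < c'" by (rule le_less_trans[rotated])
  \<comment> \<open>The radii at which the exponential lower bound holds; the aim is to show that \<open>R\<close> is one of them.\<close>
  define S where "S = {r \<in> {0..R}. \<phi> 0 * exp (c' * r) \<le> \<phi> r}"
  define t where "t = Sup S"
  have S0: "0 \<in> S" using R by (simp add: S_def)
  have bdd: "bdd_above S" unfolding S_def by (rule bdd_aboveI[of _ R]) auto
  have S_le: "r \<le> t" if "r \<in> S" for r
    unfolding t_def using that bdd by (rule cSup_upper)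
  have "t \<le> R"
    unfolding t_def using S0 by (intro cSup_least) (auto simp: S_def)
  then have t: "0 \<le> t" "t \<le> R" using S_le[OF S0] by simp_all
  have tS: "\<phi> 0 * exp (c' * t) \<le> \<phi> t"
  proof -
    define L where "L = ln (\<phi> t / \<phi> 0)"
    have quot: "0 < \<phi> t / \<phi> 0" using pos pos_r[OF t(1)] by simp
    have "r \<le> L / c'" if r: "r \<in> S" for r
    proof -
      have "0 \<le> r" using r by (simp add: S_def)
      have "\<phi> 0 * exp (c' * r) \<le> \<phi> r" using r by (simp add: S_def)
      also have "\<phi> r \<le> \<phi> t" using \<open>0 \<le> r\<close> S_le[OF r] by (rule mono)
      finally have "exp (c' * r) \<le> \<phi> t / \<phi> 0"
        using pos by (simp add: pos_le_divide_eq mult.commute)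
      then have "c' * r \<le> L"
        unfolding L_def using quot by (simp only: ln_ge_iff)
      then show ?thesis using c'0 by (simp add: pos_le_divide_eq mult.commute)
    qed
    then have "t \<le> L / c'"
      unfolding t_def using S0 by (intro cSup_least) auto
    then have "c' * t \<le> L" using c'0 by (simp add: pos_le_divide_eq mult.commute)
    then have "exp (c' * t) \<le> \<phi> t / \<phi> 0"
      unfolding L_def using quot by (simp only: ln_ge_iff)
    then show ?thesis using pos by (simp add: pos_le_divide_eq mult.commute)
  qed
  show False
  proof (cases "t < R")
    case True
    have ev: "\<forall>\<^sub>F s in at_right 0. ereal (c * \<phi> t) < ereal ((\<phi> (t + s) - \<phi> t) / s)"
      using fast[OF t(1) True] by (rule less_LiminfD)
    have "((\<lambda>s. (exp (c' * s) - 1) / s) \<longlongrightarrow> c') (at_right 0)"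
    proof -
      have "((\<lambda>s. exp (c' * s)) has_real_derivative c') (at 0)"
        by (auto intro!: derivative_eq_intros)
      then have "(\<lambda>s. (exp (c' * s) - 1) / s) \<midarrow>0\<rightarrow> c'"
        unfolding DERIV_def by simp
      then show ?thesis by (rule tendsto_mono[OF at_le, rotated]) simp
    qed
    then have ev2: "\<forall>\<^sub>F s in at_right 0. (exp (c' * s) - 1) / s < c"
      using c'(2) by (rule order_tendstoD)
    have "\<forall>\<^sub>F s in at_right 0. 0 < s \<and> s < R - t"
      by (rule eventually_at_rightI[of _ "R - t"]) (use True in simp_all)
    with ev ev2 have "\<forall>\<^sub>F s in at_right (0::real). 0 < s \<and> s < R - t \<and>
        (exp (c' * s) - 1) / s < c \<and> c * \<phi> t < (\<phi> (t + s) - \<phi> t) / s"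
      by eventually_elim simp
    from eventually_happens'[OF trivial_limit_at_right_real this]
    obtain s where s: "0 < s" "s < R - t" "(exp (c' * s) - 1) / s < c"
        "c * \<phi> t < (\<phi> (t + s) - \<phi> t) / s"
      by (elim exE conjE)
    have exp_less: "exp (c' * s) \<le> 1 + c * s"
      using s(1,3) by (simp add: pos_divide_less_eq)
    have "\<phi> 0 * exp (c' * (t + s)) = (\<phi> 0 * exp (c' * t)) * exp (c' * s)"
      by (simp add: distrib_left exp_add)
    also have "\<dots> \<le> \<phi> t * exp (c' * s)" using tS by (intro mult_right_mono) auto
    also have "\<dots> \<le> \<phi> t * (1 + c * s)"
      using exp_less less_imp_le[OF pos_r[OF t(1)]] by (rule mult_left_mono)
    also have "\<dots> \<le> \<phi> (t + s)"
    proof -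
      have "c * \<phi> t * s < \<phi> (t + s) - \<phi> t" using s(1,4) by (simp add: pos_less_divide_eq)
      then show ?thesis by (simp add: algebra_simps)
    qed
    finally have "t + s \<in> S" using s t by (simp add: S_def)
    then have "t + s \<le> t" by (rule S_le)
    then show False using s by simp
  next
    case False
    then have "t = R" using t by simp
    with tS have "exp (c' * R) \<le> \<phi> R / \<phi> 0"
      using pos by (simp add: pos_le_divide_eq mult.commute)
    then have "c' * R \<le> ln (\<phi> R / \<phi> 0)"
      using pos pos_r[of R] R by (subst ln_ge_iff) auto
    then have "c' \<le> ln (\<phi> R / \<phi> 0) / R" using R by (simp add: pos_le_divide_eq)
    then show False using c'(1) by simp
  qed
qed

section \<open>Reparametrised and piecewise continuously differentiable maps\<close>

lemma C1_differentiable_on_local: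
  fixes h :: "real \<Rightarrow> 'w::real_normed_vector"
  assumes "\<And>t. t \<in> T \<Longrightarrow> \<exists>U. open U \<and> t \<in> U \<and> h C1_differentiable_on (T \<inter> U)"
  shows "h C1_differentiable_on T"
  unfolding C1_differentiable_on_eq
proof (intro conjI ballI)
  show "h differentiable at t" if "t \<in> T" for t
    using assms[OF that] that by (auto simp: C1_differentiable_on_eq)
  show "continuous_on T (\<lambda>t. vector_derivative h (at t))"
    unfolding continuous_on_eq_continuous_within
  proof
    fix t assume t: "t \<in> T"
    obtain U where U: "open U" "t \<in> U" "h C1_differentiable_on (T \<inter> U)"
      using assms[OF t] by blast
    then have "continuous (at t within T \<inter> U) (\<lambda>t. vector_derivative h (at t))"
      using t by (auto simp: C1_differentiable_on_eq continuous_on_eq_continuous_within)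
    moreover have "at t within T \<inter> U = at t within T"
      using U by (intro at_within_nhd[of _ U]) auto
    ultimately show "continuous (at t within T) (\<lambda>t. vector_derivative h (at t))"
      by simp
  qed
qed

lemma vector_derivative_affine_reparam:
  fixes h :: "real \<Rightarrow> 'w::real_normed_vector"
  assumes "h differentiable at (b + c * t)" and "open U" "t \<in> U"
    and "\<And>s. s \<in> U \<Longrightarrow> k s = h (b + c * s)"
  shows "(k has_vector_derivative c *\<^sub>R vector_derivative h (at (b + c * t))) (at t)"
proof -
  have "((\<lambda>s. b + c * s) has_vector_derivative c) (at t)"
    by (auto intro!: derivative_eq_intros)
  then have "(h \<circ> (\<lambda>s. b + c * s) has_vector_derivative c *\<^sub>R vector_derivative h (at (b + c * t))) (at t)"
    by (rule vector_diff_chain_at) (use assms(1) vector_derivative_works in blast)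
  then show ?thesis
    by (rule has_vector_derivative_transform_within_open[OF _ assms(2,3)]) (simp add: assms(4))
qed

lemma C1_differentiable_on_affine_reparam:
  fixes h :: "real \<Rightarrow> 'w::real_normed_vector"
  assumes h: "h C1_differentiable_on T'" and U: "open U" "T \<subseteq> U"
    and T: "\<And>t. t \<in> T \<Longrightarrow> b + c * t \<in> T'"
    and k: "\<And>s. s \<in> U \<Longrightarrow> k s = h (b + c * s)"
  shows "k C1_differentiable_on T"
  unfolding C1_differentiable_on_def
proof (intro exI conjI ballI)
  show "(k has_vector_derivative c *\<^sub>R vector_derivative h (at (b + c * t))) (at t)" if "t \<in> T" for t
    using h T[OF that] that U k
    by (intro vector_derivative_affine_reparam[of _ _ _ _ U]) (auto simp: C1_differentiable_on_eq)
  have "continuous_on T' (\<lambda>t. vector_derivative h (at t))"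
    using h by (simp add: C1_differentiable_on_eq)
  then have "continuous_on T (\<lambda>t. vector_derivative h (at (b + c * t)))"
    by (rule continuous_on_compose2) (use T in \<open>auto intro!: continuous_intros\<close>)
  then show "continuous_on T (\<lambda>t. c *\<^sub>R vector_derivative h (at (b + c * t)))"
    by (intro continuous_intros)
qed

section \<open>The Riemannian distance is a pseudometric\<close>

context compact_weighted_riemannian_manifold
begin

abbreviation d where "d \<equiv> riemannian_dist X \<A> g"

definition regular_at :: "(real \<Rightarrow> 'a) \<Rightarrow> real \<Rightarrow> bool" where
  "regular_at \<gamma> t \<longleftrightarrow> (\<forall>c\<in>\<A>. \<gamma> t \<in> fst c \<longrightarrow> (snd c \<circ> \<gamma>) differentiable at t)"

lemma chosen_chart:
  assumes "p \<in> topspace X"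
  shows "(SOME c. c \<in> \<A> \<and> p \<in> fst c) \<in> \<A>" "p \<in> fst (SOME c. c \<in> \<A> \<and> p \<in> fst c)"
proof -
  have "\<exists>c. c \<in> \<A> \<and> p \<in> fst c"
    using atlas assms unfolding smooth_atlas_def by blast
  then show "(SOME c. c \<in> \<A> \<and> p \<in> fst c) \<in> \<A>" "p \<in> fst (SOME c. c \<in> \<A> \<and> p \<in> fst c)"
    using someI_ex[of "\<lambda>c. c \<in> \<A> \<and> p \<in> fst c"] by auto
qed

text \<open>The chart used to measure the speed depends only on the point of the curve. A reparametrised
  curve is thus measured in the same chart as the original one, and no change of charts enters.\<close>

lemma speed_affine_reparam:
  assumes "regular_at \<gamma> (b + c * t)" "\<gamma> (b + c * t) \<in> topspace X"
    and U: "open U" "t \<in> U" and \<eta>: "\<And>s. s \<in> U \<Longrightarrow> \<eta> s = \<gamma> (b + c * s)"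
  shows "speed \<A> g \<eta> t = \<bar>c\<bar> * speed \<A> g \<gamma> (b + c * t)"
proof -
  define c' where "c' = (SOME c'. c' \<in> \<A> \<and> \<gamma> (b + c * t) \<in> fst c')"
  define w where "w = vector_derivative (snd c' \<circ> \<gamma>) (at (b + c * t))"
  have c': "c' \<in> \<A>" "\<gamma> (b + c * t) \<in> fst c'"
    using chosen_chart[OF assms(2)] by (simp_all add: c'_def)
  have "vector_derivative (snd c' \<circ> \<eta>) (at t) = c *\<^sub>R w"
    unfolding w_def using assms(1) c' U \<eta>
    by (intro vector_derivative_at vector_derivative_affine_reparam[of _ _ _ _ U]) (auto simp: regular_at_def)
  moreover have "(c *\<^sub>R w) \<bullet> (g c' p *v (c *\<^sub>R w)) = c\<^sup>2 * (w \<bullet> (g c' p *v w))" for p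
    by (simp add: matrix_vector_mult_scaleR power2_eq_square)
  ultimately show ?thesis
    using \<eta>[OF U(2)]
    by (simp add: speed_def Let_def c'_def[symmetric] w_def[symmetric] real_sqrt_mult)
qed

lemma regular_off_finite:
  assumes "piecewise_C1_curve X \<A> \<gamma>"
  obtains S where "finite S" "\<And>t. t \<in> {0<..<1} - S \<Longrightarrow> regular_at \<gamma> t"
    "\<And>c. c \<in> \<A> \<Longrightarrow> (snd c \<circ> \<gamma>) C1_differentiable_on ({t \<in> {0<..<1}. \<gamma> t \<in> fst c} - S)"
proof -
  obtain S where S: "finite S"
    "\<forall>c\<in>\<A>. (snd c \<circ> \<gamma>) C1_differentiable_on ({t \<in> {0<..<1}. \<gamma> t \<in> fst c} - S)"
    using assms unfolding piecewise_C1_curve_def by blast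
  have "regular_at \<gamma> t" if "t \<in> {0<..<1} - S" for t
    unfolding regular_at_def
  proof (intro ballI impI)
    fix c assume "c \<in> \<A>" "\<gamma> t \<in> fst c"
    with S(2) that show "(snd c \<circ> \<gamma>) differentiable at t"
      by (auto simp: C1_differentiable_on_eq)
  qed
  with S that show thesis by blast
qed

lemma AE_lborel_off_finite: "finite S \<Longrightarrow> AE t in lborel. t \<notin> (S :: real set)"
  by (intro AE_not_in finite_imp_null_set_lborel)

lemma riemannian_dist_le_length:
  "piecewise_C1_curve X \<A> \<gamma> \<Longrightarrow> \<gamma> 0 = x \<Longrightarrow> \<gamma> 1 = y \<Longrightarrow> d x y \<le> curve_length \<A> g \<gamma>"
  unfolding riemannian_dist_def by (rule Inf_lower) blast

lemma riemannian_dist_refl: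
  assumes "x \<in> topspace X"
  shows "d x x = 0"
proof -
  have "piecewise_C1_curve X \<A> (\<lambda>_. x)"
    using assms unfolding piecewise_C1_curve_def
    by (auto simp: o_def intro!: exI[of _ "{}"])
  then have "d x x \<le> curve_length \<A> g (\<lambda>_. x)"
    by (rule riemannian_dist_le_length) auto
  also have "\<dots> = 0"
    by (simp add: curve_length_def speed_def o_def Let_def)
  finally show ?thesis by simp
qed

lemma reverse_curve:
  assumes \<gamma>: "piecewise_C1_curve X \<A> \<gamma>"
  shows "piecewise_C1_curve X \<A> (\<lambda>t. \<gamma> (1 - t))" (is ?C)
    and "curve_length \<A> g (\<lambda>t. \<gamma> (1 - t)) \<le> curve_length \<A> g \<gamma>" (is ?L)
proof -
  obtain S where S: "finite S" "\<And>t. t \<in> {0<..<1} - S \<Longrightarrow> regular_at \<gamma> t"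
    "\<And>c. c \<in> \<A> \<Longrightarrow> (snd c \<circ> \<gamma>) C1_differentiable_on ({t \<in> {0<..<1}. \<gamma> t \<in> fst c} - S)"
    using regular_off_finite[OF \<gamma>] by blast
  let ?S = "(\<lambda>s. 1 - s) ` S"
  have path: "pathin X \<gamma>" using \<gamma> by (simp add: piecewise_C1_curve_def)
  have notin: "1 - t \<notin> S" if "t \<notin> ?S" for t using that by force
  have "pathin X (\<gamma> \<circ> (\<lambda>t. 1 - t))"
    using path unfolding pathin_def
    by (intro continuous_map_compose) (auto simp: continuous_map_in_subtopology continuous_on_op_minus)
  moreover have "(snd c \<circ> (\<lambda>t. \<gamma> (1 - t))) C1_differentiable_on ({t \<in> {0<..<1}. \<gamma> (1 - t) \<in> fst c} - ?S)"
    if "c \<in> \<A>" for c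
    by (rule C1_differentiable_on_affine_reparam[OF S(3)[OF that], of UNIV _ 1 "-1"])
      (use notin in auto)
  ultimately show ?C
    unfolding piecewise_C1_curve_def using S(1)
    by (auto simp: o_def intro!: exI[of _ ?S])
  have speed: "speed \<A> g (\<lambda>t. \<gamma> (1 - t)) t = speed \<A> g \<gamma> (1 - t)" if "t \<in> {0<..<1}" "t \<notin> ?S" for t
  proof -
    have "\<gamma> (1 + -1 * t) \<in> topspace X"
      using path_image_subset_topspace[OF path] that(1) by auto
    moreover have "regular_at \<gamma> (1 + -1 * t)"
      using notin[OF that(2)] that(1) by (intro S(2)) auto
    ultimately have "speed \<A> g (\<lambda>t. \<gamma> (1 - t)) t = \<bar>-1\<bar> * speed \<A> g \<gamma> (1 + -1 * t)"
      by (intro speed_affine_reparam[of _ _ _ _ UNIV]) simp_all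
    then show ?thesis by simp
  qed
  have "AE t in lborel. t \<notin> ?S \<union> {0, 1}"
    using S(1) by (intro AE_lborel_off_finite) auto
  then have "AE t in lborel. ennreal (speed \<A> g (\<lambda>t. \<gamma> (1 - t)) t) * indicator {0..1} t =
      ennreal \<bar>-1\<bar> * (ennreal (speed \<A> g \<gamma> (1 + -1 * t)) * indicator {0..1} (1 + -1 * t))"
  proof eventually_elim
    case (elim t)
    show ?case
    proof (cases "t \<in> {0<..<1}")
      case True
      then show ?thesis using speed[of t] elim by simp
    next
      case False
      then show ?thesis using elim by (auto split: split_indicator)
    qed
  qed
  then have "curve_length \<A> g (\<lambda>t. \<gamma> (1 - t)) =
      (\<integral>\<^sup>+t. ennreal \<bar>-1\<bar> * (ennreal (speed \<A> g \<gamma> (1 + -1 * t)) * indicator {0..1} (1 + -1 * t)) \<partial>lborel)"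
    unfolding curve_length_def by (rule nn_integral_cong_AE)
  also have "\<dots> \<le> curve_length \<A> g \<gamma>"
    unfolding curve_length_def by (rule nn_integral_affine_le) simp
  finally show ?L .
qed

lemma riemannian_dist_commute: "d x y = d y x"
proof -
  have le: "d y x \<le> d x y" for x y
    unfolding riemannian_dist_def[of X \<A> g x y]
  proof (rule Inf_greatest, clarify)
    fix \<gamma> assume \<gamma>: "piecewise_C1_curve X \<A> \<gamma>" "x = \<gamma> 0" "y = \<gamma> 1"
    show "d (\<gamma> 1) (\<gamma> 0) \<le> curve_length \<A> g \<gamma>"
      by (rule order_trans[OF riemannian_dist_le_length[OF reverse_curve(1)[OF \<gamma>(1)]] reverse_curve(2)[OF \<gamma>(1)]])
        auto
  qed
  show ?thesis using le[of x y] le[of y x] by simp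
qed

text \<open>The counterpart of \<open>(+++)\<close> for curves in an explicit topological space.\<close>

definition concat_curve :: "(real \<Rightarrow> 'a) \<Rightarrow> (real \<Rightarrow> 'a) \<Rightarrow> real \<Rightarrow> 'a" where
  "concat_curve \<gamma> \<eta> t = (if t \<le> 1/2 then \<gamma> (2 * t) else \<eta> (2 * t - 1))"

lemma pathin_concat_curve:
  assumes "pathin X \<gamma>" "pathin X \<eta>" "\<gamma> 1 = \<eta> 0"
  shows "pathin X (concat_curve \<gamma> \<eta>)"
  unfolding pathin_def concat_curve_def[abs_def]
proof (rule continuous_map_cases_le)
  let ?I = "top_of_set {0..1::real}"
  have "continuous_map (subtopology ?I {t \<in> topspace ?I. t \<le> 1/2}) ?I (\<lambda>t. 2 * t)"
    by (auto simp: continuous_map_in_subtopology intro!: continuous_intros continuous_map_from_subtopology)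
  then show "continuous_map (subtopology ?I {t \<in> topspace ?I. t \<le> 1/2}) X (\<lambda>t. \<gamma> (2 * t))"
    using continuous_map_compose[of _ ?I _ X \<gamma>] assms(1) by (auto simp: pathin_def o_def)
  have "continuous_map (subtopology ?I {t \<in> topspace ?I. 1/2 \<le> t}) ?I (\<lambda>t. 2 * t - 1)"
    by (auto simp: continuous_map_in_subtopology intro!: continuous_intros continuous_map_from_subtopology)
  then show "continuous_map (subtopology ?I {t \<in> topspace ?I. 1/2 \<le> t}) X (\<lambda>t. \<eta> (2 * t - 1))"
    using continuous_map_compose[of _ ?I _ X \<eta>] assms(2) by (auto simp: pathin_def o_def)
  show "\<gamma> (2 * t) = \<eta> (2 * t - 1)" if "t = 1/2" for t
  proof -
    have "2 * t = 1" using that by simp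
    then show ?thesis using assms(3) by (simp only: diff_self)
  qed
qed (auto intro!: continuous_map_from_subtopology)

text \<open>Both halves are traversed at double speed, and the interval of each half is mapped onto the
  unit interval by an affine map. The point where the halves meet joins the finite exceptional set.\<close>

lemma concat_curves:
  assumes \<gamma>: "piecewise_C1_curve X \<A> \<gamma>" and \<eta>: "piecewise_C1_curve X \<A> \<eta>" and eq: "\<gamma> 1 = \<eta> 0"
  shows "piecewise_C1_curve X \<A> (concat_curve \<gamma> \<eta>)" (is ?C)
    and "curve_length \<A> g (concat_curve \<gamma> \<eta>) \<le> curve_length \<A> g \<gamma> + curve_length \<A> g \<eta>" (is ?L)
proof -
  obtain S where S: "finite S" "\<And>t. t \<in> {0<..<1} - S \<Longrightarrow> regular_at \<gamma> t"
    "\<And>c. c \<in> \<A> \<Longrightarrow> (snd c \<circ> \<gamma>) C1_differentiable_on ({t \<in> {0<..<1}. \<gamma> t \<in> fst c} - S)"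
    using regular_off_finite[OF \<gamma>] by blast
  obtain S' where S': "finite S'" "\<And>t. t \<in> {0<..<1} - S' \<Longrightarrow> regular_at \<eta> t"
    "\<And>c. c \<in> \<A> \<Longrightarrow> (snd c \<circ> \<eta>) C1_differentiable_on ({t \<in> {0<..<1}. \<eta> t \<in> fst c} - S')"
    using regular_off_finite[OF \<eta>] by blast
  let ?j = "concat_curve \<gamma> \<eta>"
  \<comment> \<open>The new exceptional set: the junction and the preimages of the old exceptional parameters.\<close>
  define Q where "Q = {1/2} \<union> (\<lambda>s. s / 2) ` S \<union> (\<lambda>s. (s + 1) / 2) ` S'"
  have finQ: "finite Q" and half: "1/2 \<in> Q" using S(1) S'(1) by (simp_all add: Q_def)
  have path: "pathin X \<gamma>" "pathin X \<eta>" using \<gamma> \<eta> by (simp_all add: piecewise_C1_curve_def)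
  have left: "?j s = \<gamma> (0 + 2 * s)" if "s \<in> {..<1/2}" for s using that by (simp add: concat_curve_def)
  have right: "?j s = \<eta> (-1 + 2 * s)" if "s \<in> {1/2<..}" for s using that by (simp add: concat_curve_def)
  have notin: "0 + 2 * t \<notin> S" "-1 + 2 * t \<notin> S'" if "t \<notin> Q" for t
  proof -
    have "t \<in> Q" if "0 + 2 * t \<in> S"
      using imageI[OF that, of "\<lambda>s. s / 2"] by (simp add: Q_def)
    moreover have "t \<in> Q" if "-1 + 2 * t \<in> S'"
      using imageI[OF that, of "\<lambda>s. (s + 1) / 2"] by (simp add: Q_def)
    ultimately show "0 + 2 * t \<notin> S" "-1 + 2 * t \<notin> S'" using that by blast+
  qed
  have "(snd c \<circ> ?j) C1_differentiable_on ({t \<in> {0<..<1}. ?j t \<in> fst c} - Q)" if c: "c \<in> \<A>" for c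
  proof (rule C1_differentiable_on_local)
    fix t assume t: "t \<in> {t \<in> {0<..<1}. ?j t \<in> fst c} - Q"
    let ?T = "{t \<in> {0<..<1}. ?j t \<in> fst c} - Q"
    have "(snd c \<circ> ?j) C1_differentiable_on (?T \<inter> {..<1/2})"
    proof (rule C1_differentiable_on_affine_reparam[OF S(3)[OF c], of "{..<1/2}" _ 0 2])
      show "0 + 2 * s \<in> {t \<in> {0<..<1}. \<gamma> t \<in> fst c} - S" if "s \<in> ?T \<inter> {..<1/2}" for s
        using that notin(1)[of s] left[of s] by auto
      show "(snd c \<circ> ?j) s = (snd c \<circ> \<gamma>) (0 + 2 * s)" if "s \<in> {..<1/2}" for s
        using left[OF that] by simp
    qed auto
    moreover have "(snd c \<circ> ?j) C1_differentiable_on (?T \<inter> {1/2<..})"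
    proof (rule C1_differentiable_on_affine_reparam[OF S'(3)[OF c], of "{1/2<..}" _ "-1" 2])
      show "-1 + 2 * s \<in> {t \<in> {0<..<1}. \<eta> t \<in> fst c} - S'" if "s \<in> ?T \<inter> {1/2<..}" for s
        using that notin(2)[of s] right[of s] by auto
      show "(snd c \<circ> ?j) s = (snd c \<circ> \<eta>) (-1 + 2 * s)" if "s \<in> {1/2<..}" for s
        using right[OF that] by simp
    qed auto
    moreover have "t \<in> {..<1/2} \<or> t \<in> {1/2<..}"
      using t half by (cases t "1/2 :: real" rule: linorder_cases) auto
    ultimately show "\<exists>U. open U \<and> t \<in> U \<and> (snd c \<circ> ?j) C1_differentiable_on (?T \<inter> U)"
      using open_lessThan[of "1/2 :: real"] open_greaterThan[of "1/2 :: real"] by blast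
  qed
  with finQ show ?C
    unfolding piecewise_C1_curve_def using pathin_concat_curve[OF path eq] by blast
  let ?u = "\<lambda>t. ennreal \<bar>2\<bar> * (ennreal (speed \<A> g \<gamma> (0 + 2 * t)) * indicator {0..1} (0 + 2 * t))"
  let ?v = "\<lambda>t. ennreal \<bar>2\<bar> * (ennreal (speed \<A> g \<eta> (-1 + 2 * t)) * indicator {0..1} (-1 + 2 * t))"
  have sleft: "speed \<A> g ?j t = 2 * speed \<A> g \<gamma> (0 + 2 * t)" if "t \<in> {0<..<1/2}" "t \<notin> Q" for t
  proof -
    have "\<gamma> (0 + 2 * t) \<in> topspace X"
      using path_image_subset_topspace[OF path(1)] that(1) by auto
    moreover have "regular_at \<gamma> (0 + 2 * t)"
      using notin(1)[OF that(2)] that(1) by (intro S(2)) auto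
    ultimately have "speed \<A> g ?j t = \<bar>2\<bar> * speed \<A> g \<gamma> (0 + 2 * t)"
      by (intro speed_affine_reparam[of _ _ _ _ "{..<1/2}"]) (use that(1) left in auto)
    then show ?thesis by simp
  qed
  have sright: "speed \<A> g ?j t = 2 * speed \<A> g \<eta> (-1 + 2 * t)" if "t \<in> {1/2<..<1}" "t \<notin> Q" for t
  proof -
    have "\<eta> (-1 + 2 * t) \<in> topspace X"
      using path_image_subset_topspace[OF path(2)] that(1) by auto
    moreover have "regular_at \<eta> (-1 + 2 * t)"
      using notin(2)[OF that(2)] that(1) by (intro S'(2)) auto
    ultimately have "speed \<A> g ?j t = \<bar>2\<bar> * speed \<A> g \<eta> (-1 + 2 * t)"
      by (intro speed_affine_reparam[of _ _ _ _ "{1/2<..}"]) (use that(1) right in auto)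
    then show ?thesis by simp
  qed
  let ?h = "\<lambda>t. ennreal (speed \<A> g ?j t) * indicator ({0<..<1} - Q) t"
  have "AE t in lborel. t \<notin> Q \<union> {0, 1}"
    using finQ by (intro AE_lborel_off_finite) auto
  then have "AE t in lborel. ennreal (speed \<A> g ?j t) * indicator {0..1} t = ?h t"
    by eventually_elim (auto split: split_indicator)
  then have "curve_length \<A> g ?j = (\<integral>\<^sup>+t. ?h t \<partial>lborel)"
    unfolding curve_length_def by (rule nn_integral_cong_AE)
  also have "\<dots> \<le> (\<integral>\<^sup>+t. ?u t \<partial>lborel) + (\<integral>\<^sup>+t. ?v t \<partial>lborel)"
  proof (rule nn_integral_split_le[of "{..<1/2}"])
    show "?h t \<le> ?u t" if "t \<in> {..<1/2}" for t
    proof (cases "t \<in> {0<..<1} - Q")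
      case True
      then have "t \<in> {0<..<1/2}" using that by auto
      then show ?thesis using sleft[of t] True by (simp add: ennreal_mult')
    qed simp
    show "?h t \<le> ?v t" if "t \<notin> {..<1/2}" for t
    proof (cases "t \<in> {0<..<1} - Q")
      case True
      then have "t \<noteq> 1/2" using half by blast
      then have "t \<in> {1/2<..<1}" using that True by auto
      then show ?thesis using sright[of t] True by (simp add: ennreal_mult')
    qed simp
  qed simp
  also have "\<dots> \<le> curve_length \<A> g \<gamma> + curve_length \<A> g \<eta>"
    unfolding curve_length_def by (intro add_mono nn_integral_affine_le) simp_all
  finally show ?L .
qed

lemma riemannian_dist_triangle: "d x z \<le> d x y + d y z"
proof (rule ennreal_le_epsilon)
  fix e :: real assume fin: "d x y + d y z < top" and e: "0 < e"
  have near: "\<exists>\<gamma>. piecewise_C1_curve X \<A> \<gamma> \<and> \<gamma> 0 = p \<and> \<gamma> 1 = q \<and> curve_length \<A> g \<gamma> < d p q + ennreal (e / 2)"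
    if "d p q < top" for p q
  proof -
    have "d p q < d p q + ennreal (e / 2)" using that e by (simp add: ennreal_zero_less_divide)
    then show ?thesis
      by (subst (asm) (1) riemannian_dist_def) (auto simp: Inf_less_iff)
  qed
  obtain \<gamma> where \<gamma>: "piecewise_C1_curve X \<A> \<gamma>" "\<gamma> 0 = x" "\<gamma> 1 = y"
    "curve_length \<A> g \<gamma> < d x y + ennreal (e / 2)"
    using near[of x y] fin by auto
  obtain \<eta> where \<eta>: "piecewise_C1_curve X \<A> \<eta>" "\<eta> 0 = y" "\<eta> 1 = z"
    "curve_length \<A> g \<eta> < d y z + ennreal (e / 2)"
    using near[of y z] fin by auto
  have "d x z \<le> curve_length \<A> g (concat_curve \<gamma> \<eta>)"
    using \<gamma> \<eta> by (intro riemannian_dist_le_length concat_curves) (auto simp: concat_curve_def)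
  also have "\<dots> \<le> curve_length \<A> g \<gamma> + curve_length \<A> g \<eta>"
    using \<gamma> \<eta> by (intro concat_curves) auto
  also have "\<dots> \<le> (d x y + ennreal (e / 2)) + (d y z + ennreal (e / 2))"
    using \<gamma>(4) \<eta>(4) by (intro add_mono) auto
  also have "\<dots> = d x y + d y z + (ennreal (e / 2) + ennreal (e / 2))"
    by (simp add: ac_simps)
  also have "ennreal (e / 2) + ennreal (e / 2) = ennreal e"
    using e by (simp add: ennreal_plus[symmetric] del: ennreal_plus)
  finally show "d x z \<le> d x y + d y z + ennreal e" .
qed

end

section \<open>Points that are close in a chart have small Riemannian distance\<close>

lemma convex_half_space: "convex (half_space :: (real ^ 'n::finite) set)"
  unfolding half_space_def convex_def by auto

text \<open>Bounding the form by the norm of its matrix makes continuity of the metric components yield a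
  uniform bound near a point.\<close>

lemma quadratic_form_le:
  fixes M :: "real ^ 'n::finite ^ 'n"
  assumes "norm M \<le> N"
  shows "v \<bullet> (M *v v) \<le> real CARD('n) * real CARD('n) * N * (norm v)\<^sup>2"
proof -
  have "\<bar>M $ i $ j\<bar> \<le> N" for i j
    using order_trans[OF component_le_norm_cart[of "M $ i" j] Finite_Cartesian_Product.norm_nth_le[of M i]] assms by simp
  then have "onorm ((*v) M) \<le> real CARD('n) * real CARD('n) * N"
    by (rule onorm_le_matrix_component)
  moreover have "norm (M *v v) \<le> onorm ((*v) M) * norm v"
    by (intro onorm matrix_vector_mul_bounded_linear)
  ultimately have "norm (M *v v) \<le> (real CARD('n) * real CARD('n) * N) * norm v"
    by (meson mult_right_mono norm_ge_zero order_trans)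
  then have "norm v * norm (M *v v) \<le> norm v * ((real CARD('n) * real CARD('n) * N) * norm v)"
    by (rule mult_left_mono) simp
  moreover have "v \<bullet> (M *v v) \<le> norm v * norm (M *v v)"
    by (rule norm_cauchy_schwarz)
  ultimately show ?thesis by (simp add: power2_eq_square ac_simps)
qed

context compact_weighted_riemannian_manifold
begin

lemma chart_subset_topspace: "c \<in> \<A> \<Longrightarrow> fst c \<subseteq> topspace X"
  using atlas by (auto simp: smooth_atlas_def)

lemma chart_facts:
  assumes c: "c \<in> \<A>"
  shows chart_inv_chart: "\<And>q. q \<in> fst c \<Longrightarrow> chart_inv c (snd c q) = q"
    and chart_chart_inv: "\<And>x. x \<in> snd c ` fst c \<Longrightarrow> snd c (chart_inv c x) = x"
    and chart_inv_in: "\<And>x. x \<in> snd c ` fst c \<Longrightarrow> chart_inv c x \<in> fst c"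
    and chart_image_open: "openin (top_of_set half_space) (snd c ` fst c)"
    and continuous_chart_inv: "continuous_map (top_of_set (snd c ` fst c)) X (chart_inv c)"
    and openin_chart_preimage: "\<And>W. open W \<Longrightarrow> openin X {q \<in> fst c. snd c q \<in> W}"
    and openin_chart_image: "\<And>V. openin X V \<Longrightarrow> openin (top_of_set half_space) (snd c ` (fst c \<inter> V))"
proof -
  have ch: "openin X (fst c)" "openin (top_of_set half_space) (snd c ` fst c)"
    "homeomorphic_map (subtopology X (fst c)) (top_of_set (snd c ` fst c)) (snd c)"
    using atlas c unfolding smooth_atlas_def is_chart_def by auto
  have top: "topspace (subtopology X (fst c)) = fst c"
    using openin_subset[OF ch(1)] by (auto simp: topspace_subtopology)
  have inj: "inj_on (snd c) (fst c)"
    using homeomorphic_imp_injective_map[OF ch(3)] top by simp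
  show 1: "\<And>q. q \<in> fst c \<Longrightarrow> chart_inv c (snd c q) = q"
    unfolding chart_inv_def using inj by simp
  show 2: "\<And>x. x \<in> snd c ` fst c \<Longrightarrow> snd c (chart_inv c x) = x"
    unfolding chart_inv_def by (rule f_inv_into_f)
  show 3: "\<And>x. x \<in> snd c ` fst c \<Longrightarrow> chart_inv c x \<in> fst c"
    unfolding chart_inv_def by (rule inv_into_into)
  show "openin (top_of_set half_space) (snd c ` fst c)" by fact
  obtain h where h: "homeomorphic_maps (subtopology X (fst c)) (top_of_set (snd c ` fst c)) (snd c) h"
    using ch(3) homeomorphic_map_maps by blast
  then have "continuous_map (top_of_set (snd c ` fst c)) X h"
    by (auto simp: homeomorphic_maps_def continuous_map_in_subtopology)
  moreover have "h x = chart_inv c x" if "x \<in> topspace (top_of_set (snd c ` fst c))" for x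
    using h that 1 openin_subset[OF ch(1)] by (auto simp: homeomorphic_maps_def subset_iff)
  ultimately show "continuous_map (top_of_set (snd c ` fst c)) X (chart_inv c)"
    by (rule continuous_map_eq)
  show "openin X {q \<in> fst c. snd c q \<in> W}" if "open W" for W
  proof -
    have "openin (subtopology X (fst c)) {q \<in> topspace (subtopology X (fst c)). snd c q \<in> snd c ` fst c \<inter> W}"
      using homeomorphic_imp_continuous_map[OF ch(3)] openin_open_Int[OF that]
      by (rule openin_continuous_map_preimage)
    moreover have "{q \<in> topspace (subtopology X (fst c)). snd c q \<in> snd c ` fst c \<inter> W} = {q \<in> fst c. snd c q \<in> W}"
      unfolding top by blast
    ultimately show ?thesis
      using ch(1) by (simp add: openin_open_subtopology)
  qed
  show "openin (top_of_set half_space) (snd c ` (fst c \<inter> V))" if "openin X V" for V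
  proof -
    have "openin (subtopology X (fst c)) (fst c \<inter> V)"
      using that by (rule openin_subtopology_Int2)
    then have "openin (top_of_set (snd c ` fst c)) (snd c ` (fst c \<inter> V))"
      using homeomorphic_imp_open_map[OF ch(3)] by (simp add: open_map_def)
    then show ?thesis using ch(2) openin_trans by blast
  qed
qed

text \<open>Seen from another chart, a coordinate segment is its image under the transition map. Near each
  of its points the transition map extends to a smooth map on an open set of the vector space, which
  makes sense of its derivative at boundary points and gives the regularity of the image.\<close>

lemma transition_along_segment:
  fixes x y :: "real ^ 'n"
  defines "l \<equiv> \<lambda>t. x + t *\<^sub>R (y - x)"
  assumes c: "c \<in> \<A>" "c' \<in> \<A>" and seg: "closed_segment x y \<subseteq> snd c ` fst c"
    and t: "t \<in> {0<..<1}" "chart_inv c (l t) \<in> fst c'"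
  obtains N where "open N" "t \<in> N" "l ` N \<subseteq> overlap c c'"
    "(transition c c' \<circ> l) C1_differentiable_on N"
    "transition c c' differentiable (at (l t) within overlap c c')"
proof -
  have l_seg: "l s \<in> closed_segment x y" if "s \<in> {0..1}" for s
    using that unfolding l_def in_segment by (auto intro!: exI[of _ s] simp: algebra_simps)
  have l_cont: "continuous_on UNIV l"
    unfolding l_def by (intro continuous_intros)
  have l_deriv: "(l has_vector_derivative (y - x)) (at s)" for s
    unfolding l_def by (auto intro!: derivative_eq_intros)
  have "openin X (fst c')"
    using atlas c(2) unfolding smooth_atlas_def is_chart_def by auto
  then have "openin (top_of_set half_space) (overlap c c')"
    unfolding overlap_def by (rule openin_chart_image[OF c(1)])
  then obtain O' where O: "open O'" "overlap c c' = half_space \<inter> O'"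
    by (auto simp: openin_open)
  have img: "snd c ` fst c \<subseteq> half_space"
    using chart_image_open[OF c(1)] by (rule openin_imp_subset)
  have lt: "l t \<in> overlap c c'"
    unfolding overlap_def
  proof (rule image_eqI)
    have "l t \<in> snd c ` fst c" using l_seg[of t] seg t by auto
    then show "l t = snd c (chart_inv c (l t))" "chart_inv c (l t) \<in> fst c \<inter> fst c'"
      using chart_chart_inv[OF c(1)] chart_inv_in[OF c(1)] t(2) by auto
  qed
  have "smooth_on (overlap c c') (transition c c')"
    using atlas c unfolding smooth_atlas_def by auto
  then obtain W G where W: "open W" "l t \<in> W" "\<forall>k. Ck_on k W G"
    "\<forall>z\<in>overlap c c' \<inter> W. G z = transition c c' z"
    using lt unfolding smooth_on_def by meson
  have G: "G differentiable (at z)" if "z \<in> W" for z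
    using W(3)[rule_format, of "Suc 0"] that by simp
  have G': "continuous_on W (\<lambda>z. frechet_derivative G (at z) v)" for v
    using W(3)[rule_format, of "Suc 0"] by simp
  define N where "N = {0<..<1} \<inter> l -` (O' \<inter> W)"
  have N: "open N" "t \<in> N"
    using O W lt t l_cont unfolding N_def
    by (auto intro!: open_Int continuous_open_vimage simp: continuous_on_eq_continuous_at)
  have lN: "l ` N \<subseteq> overlap c c'" "l ` N \<subseteq> W"
    unfolding O(2) N_def using l_seg seg img by fastforce+
  have "(transition c c' \<circ> l) C1_differentiable_on N"
    unfolding C1_differentiable_on_def
  proof (intro exI conjI ballI)
    fix s assume s: "s \<in> N"
    have "(G has_derivative frechet_derivative G (at (l s))) (at (l s))"
      using G lN s frechet_derivative_works by blast
    then have "(G \<circ> l has_vector_derivative frechet_derivative G (at (l s)) (y - x)) (at s)"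
      using vector_derivative_diff_chain_within[OF l_deriv has_derivative_at_withinI] by blast
    then show "(transition c c' \<circ> l has_vector_derivative frechet_derivative G (at (l s)) (y - x)) (at s)"
      by (rule has_vector_derivative_transform_within_open[OF _ N(1) s]) (use lN W(4) in auto)
  next
    show "continuous_on N (\<lambda>s. frechet_derivative G (at (l s)) (y - x))"
      by (rule continuous_on_compose2[OF G']) (use lN l_cont in \<open>auto intro: continuous_on_subset\<close>)
  qed
  moreover have "transition c c' differentiable (at (l t) within overlap c c')"
  proof -
    obtain e where e: "0 < e" "ball (l t) e \<subseteq> W"
      using W(1,2) openE by blast
    obtain G0 where "(G has_derivative G0) (at (l t))"
      using G[OF W(2)] unfolding differentiable_def by blast
    then have "(G has_derivative G0) (at (l t) within overlap c c')"
      by (rule has_derivative_at_withinI)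
    then have "(transition c c' has_derivative G0) (at (l t) within overlap c c')"
    proof (rule has_derivative_transform_within[OF _ e(1) lt])
      fix z assume "z \<in> overlap c c'" "dist z (l t) < e"
      moreover from this have "z \<in> W" using e(2) by (auto simp: dist_commute)
      ultimately show "G z = transition c c' z" using W(4) by simp
    qed
    then show ?thesis unfolding differentiable_def by blast
  qed
  ultimately show thesis using that N lN(1) by blast
qed

text \<open>The segment in the coordinates of \<open>c\<close> is a competitor for the distance. Its speed is defined
  through the chart chosen at the point, but the transformation law of the metric turns it into the
  norm of the constant velocity \<open>y - x\<close> with respect to the Gram matrix of \<open>c\<close>.\<close>

lemma riemannian_dist_segment_le:
  fixes x y :: "real ^ 'n"
  assumes c: "c \<in> \<A>" and seg: "closed_segment x y \<subseteq> snd c ` fst c" and K: "0 \<le> K"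
    and bound: "\<And>z v. z \<in> closed_segment x y \<Longrightarrow> v \<bullet> (g c (chart_inv c z) *v v) \<le> K\<^sup>2 * (norm v)\<^sup>2"
  shows "d (chart_inv c x) (chart_inv c y) \<le> ennreal (K * norm (y - x))"
proof -
  define l where "l = (\<lambda>t. x + t *\<^sub>R (y - x))"
  define \<gamma> where "\<gamma> = chart_inv c \<circ> l"
  have l_seg: "l s \<in> closed_segment x y" if "s \<in> {0..1}" for s
    using that unfolding l_def in_segment by (auto intro!: exI[of _ s] simp: algebra_simps)
  have l_cont: "continuous_on {0..1} l"
    unfolding l_def by (intro continuous_intros)
  have l_deriv: "(l has_vector_derivative (y - x)) (at s within T)" for s T
    unfolding l_def by (auto intro!: derivative_eq_intros)
  have sub: "\<gamma> t \<in> topspace X" "\<gamma> t \<in> fst c" "snd c (\<gamma> t) = l t" if "t \<in> {0..1}" for t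
  proof -
    have "l t \<in> snd c ` fst c" using l_seg[OF that] seg by auto
    then show "\<gamma> t \<in> fst c" "snd c (\<gamma> t) = l t"
      unfolding \<gamma>_def o_def by (rule chart_inv_in[OF c], rule chart_chart_inv[OF c])
    then show "\<gamma> t \<in> topspace X"
      using chart_subset_topspace[OF c] by (simp add: subset_iff)
  qed
  have path: "pathin X \<gamma>"
    unfolding pathin_def \<gamma>_def
  proof (rule continuous_map_compose[OF _ continuous_chart_inv[OF c]])
    show "continuous_map (top_of_set {0..1}) (top_of_set (snd c ` fst c)) l"
      using l_cont l_seg seg by (auto simp: continuous_map_in_subtopology)
  qed
  have in_chart: "snd c' \<circ> \<gamma> = transition c c' \<circ> l" for c'
    unfolding \<gamma>_def transition_def by (simp only: o_assoc)
  have C1: "piecewise_C1_curve X \<A> \<gamma>"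
    unfolding piecewise_C1_curve_def
  proof (intro conjI path exI[of _ "{}"] finite.emptyI ballI)
    fix c' assume c': "c' \<in> \<A>"
    show "(snd c' \<circ> \<gamma>) C1_differentiable_on ({t \<in> {0<..<1}. \<gamma> t \<in> fst c'} - {})"
    proof (rule C1_differentiable_on_local)
      fix t assume "t \<in> {t \<in> {0<..<1}. \<gamma> t \<in> fst c'} - {}"
      then have t: "t \<in> {0<..<1}" "chart_inv c (x + t *\<^sub>R (y - x)) \<in> fst c'"
        by (auto simp: \<gamma>_def l_def)
      from transition_along_segment[OF c c' seg t, folded l_def]
      obtain N where N: "open N" "t \<in> N" "(transition c c' \<circ> l) C1_differentiable_on N" .
      from N(3) have "(snd c' \<circ> \<gamma>) C1_differentiable_on (({t \<in> {0<..<1}. \<gamma> t \<in> fst c'} - {}) \<inter> N)"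
        unfolding in_chart by (rule C1_differentiable_on_subset) simp
      with N(1,2) show "\<exists>U. open U \<and> t \<in> U \<and>
          (snd c' \<circ> \<gamma>) C1_differentiable_on (({t \<in> {0<..<1}. \<gamma> t \<in> fst c'} - {}) \<inter> U)"
        by (intro exI conjI)
    qed
  qed
  have speed: "speed \<A> g \<gamma> t \<le> K * norm (y - x)" if t: "t \<in> {0<..<1}" for t
  proof -
    define c' where "c' = (SOME c'. c' \<in> \<A> \<and> \<gamma> t \<in> fst c')"
    have c': "c' \<in> \<A>" "\<gamma> t \<in> fst c'"
      unfolding c'_def using t by (intro chosen_chart sub(1); simp)+
    then have "chart_inv c (x + t *\<^sub>R (y - x)) \<in> fst c'" by (simp add: \<gamma>_def l_def)
    from transition_along_segment[OF c c'(1) seg t this]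
    obtain N where N: "open N" "t \<in> N" "l ` N \<subseteq> overlap c c'"
      "transition c c' differentiable (at (l t) within overlap c c')"
      unfolding l_def .
    define D where "D = frechet_derivative (transition c c') (at (l t) within overlap c c')"
    \<comment> \<open>The chain rule applies to every derivative within the overlap, in particular to the chosen one.\<close>
    have "(transition c c' has_derivative D) (at (l t) within overlap c c')"
      unfolding D_def by (rule frechet_derivative_works[THEN iffD1, OF N(4)])
    then have "(transition c c' has_derivative D) (at (l t) within l ` N)"
      using N(3) by (rule has_derivative_subset)
    then have "(transition c c' \<circ> l has_vector_derivative D (y - x)) (at t within N)"
      by (rule vector_derivative_diff_chain_within[OF l_deriv])
    then have "vector_derivative (snd c' \<circ> \<gamma>) (at t) = D (y - x)"
      unfolding in_chart at_within_open[OF N(2,1)] by (rule vector_derivative_at)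
    then have "speed \<A> g \<gamma> t = sqrt (D (y - x) \<bullet> (g c' (\<gamma> t) *v D (y - x)))"
      unfolding speed_def Let_def c'_def[symmetric] by (simp only:)
    also have "D (y - x) \<bullet> (g c' (\<gamma> t) *v D (y - x)) = (y - x) \<bullet> (g c (\<gamma> t) *v (y - x))"
    proof -
      have "\<gamma> t \<in> fst c \<inter> fst c'" "snd c (\<gamma> t) = l t" using c' sub t by auto
      moreover have "\<forall>c\<in>\<A>. \<forall>c'\<in>\<A>. \<forall>p\<in>fst c \<inter> fst c'. \<forall>v w. v \<bullet> (g c p *v w) =
          frechet_derivative (transition c c') (at (snd c p) within overlap c c') v \<bullet>
          (g c' p *v frechet_derivative (transition c c') (at (snd c p) within overlap c c') w)"
        using metric unfolding riemannian_metric_def Let_def by (elim conjE)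
      ultimately have "(y - x) \<bullet> (g c (\<gamma> t) *v (y - x)) =
          frechet_derivative (transition c c') (at (snd c (\<gamma> t)) within overlap c c') (y - x) \<bullet>
          (g c' (\<gamma> t) *v frechet_derivative (transition c c') (at (snd c (\<gamma> t)) within overlap c c') (y - x))"
        using c c'(1) by blast
      then show ?thesis by (simp only: D_def \<open>snd c (\<gamma> t) = l t\<close>)
    qed
    also have "sqrt \<dots> \<le> sqrt (K\<^sup>2 * (norm (y - x))\<^sup>2)"
    proof (rule real_sqrt_le_mono)
      have "l t \<in> closed_segment x y" using t by (intro l_seg) simp
      then show "(y - x) \<bullet> (g c (\<gamma> t) *v (y - x)) \<le> K\<^sup>2 * (norm (y - x))\<^sup>2"
        unfolding \<gamma>_def o_def by (rule bound)
    qed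
    also have "\<dots> = K * norm (y - x)"
      using K by (simp add: real_sqrt_mult)
    finally show ?thesis .
  qed
  have "d (chart_inv c x) (chart_inv c y) \<le> curve_length \<A> g \<gamma>"
    using C1 by (rule riemannian_dist_le_length) (auto simp: \<gamma>_def l_def)
  also have "\<dots> \<le> (\<integral>\<^sup>+t. ennreal (K * norm (y - x)) * indicator {0..1} (t :: real) \<partial>lborel)"
    unfolding curve_length_def
  proof (rule nn_integral_mono_AE)
    have "AE t in lborel. t \<notin> {0, 1::real}" by (intro AE_lborel_off_finite) auto
    then show "AE t in lborel. ennreal (speed \<A> g \<gamma> t) * indicator {0..1} t
        \<le> ennreal (K * norm (y - x)) * indicator {0..1} t"
    proof eventually_elim
      case (elim t)
      then show ?case using speed[of t] by (auto split: split_indicator intro!: ennreal_leI)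
    qed
  qed
  also have "\<dots> = ennreal (K * norm (y - x))"
    by (simp add: nn_integral_cmult_indicator)
  finally show ?thesis .
qed

text \<open>The metric is bounded near \<open>p\<close> in a chart, so coordinate segments issuing from \<open>p\<close> are short.
  A coordinate ball around a boundary point is cut by the half-space, which is convex; hence the
  segments remain in the image of the chart.\<close>

lemma riemannian_dist_small_nearby:
  assumes p: "p \<in> topspace X" and e: "0 < e"
  obtains V where "openin X V" "p \<in> V" "\<And>q. q \<in> V \<Longrightarrow> d p q < ennreal e"
proof -
  obtain c where c: "c \<in> \<A>" "p \<in> fst c"
    using atlas p unfolding smooth_atlas_def by blast
  let ?x = "snd c p"
  have x: "?x \<in> snd c ` fst c" using c by simp
  have "smooth_on (snd c ` fst c) (\<lambda>x. g c (chart_inv c x))"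
    using metric c unfolding riemannian_metric_def by blast
  then obtain W G where W: "open W" "?x \<in> W" "\<forall>k. Ck_on k W G"
    "\<forall>z\<in>snd c ` fst c \<inter> W. G z = g c (chart_inv c z)"
    using x unfolding smooth_on_def by meson
  have "continuous_on W G" using W(3)[rule_format, of 0] by simp
  then have "open (W \<inter> G -` ball 0 (norm (G ?x) + 1))"
    using W(1) by (intro continuous_open_preimage) auto
  moreover have "?x \<in> W \<inter> G -` ball 0 (norm (G ?x) + 1)" using W(2) by simp
  ultimately obtain r1 where r1: "0 < r1" "ball ?x r1 \<subseteq> W \<inter> G -` ball 0 (norm (G ?x) + 1)"
    using openE by blast
  obtain O' where O: "open O'" "snd c ` fst c = half_space \<inter> O'"
    using chart_image_open[OF c(1)] by (auto simp: openin_open)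
  obtain r2 where r2: "0 < r2" "ball ?x r2 \<subseteq> O'"
    using O x openE by blast
  define K where "K = sqrt (real CARD('n) * real CARD('n) * (norm (G ?x) + 1))"
  have K: "0 \<le> K" "K\<^sup>2 = real CARD('n) * real CARD('n) * (norm (G ?x) + 1)"
    by (simp_all add: K_def)
  define r where "r = min (min r1 r2) (e / (K + 1))"
  have r: "0 < r" "r \<le> r1" "r \<le> r2" "r \<le> e / (K + 1)"
    using r1 r2 e K by (auto simp: r_def)
  let ?V = "{q \<in> fst c. snd c q \<in> ball ?x r}"
  show thesis
  proof
    show "openin X ?V" by (rule openin_chart_preimage[OF c(1)]) simp
    show "p \<in> ?V" using c r by simp
    fix q assume q: "q \<in> ?V"
    have in_ball: "closed_segment ?x (snd c q) \<subseteq> ball ?x r"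
      using q r by (intro closed_segment_subset) auto
    moreover have "closed_segment ?x (snd c q) \<subseteq> half_space"
      using q x O(2) c convex_half_space by (intro closed_segment_subset) auto
    ultimately have seg: "closed_segment ?x (snd c q) \<subseteq> snd c ` fst c"
      using r r2 O(2) subset_ball[of r r2 ?x] by blast
    have "d (chart_inv c ?x) (chart_inv c (snd c q)) \<le> ennreal (K * norm (snd c q - ?x))"
    proof (rule riemannian_dist_segment_le[OF c(1) seg K(1)])
      fix z v assume z: "z \<in> closed_segment ?x (snd c q)"
      then have "z \<in> ball ?x r1" using in_ball r subset_ball[of r r1 ?x] by blast
      then have "norm (g c (chart_inv c z)) \<le> norm (G ?x) + 1"
        using r1 W(4) z seg by fastforce
      then show "v \<bullet> (g c (chart_inv c z) *v v) \<le> K\<^sup>2 * (norm v)\<^sup>2"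
        unfolding K(2) by (rule quadratic_form_le)
    qed
    moreover have "K * norm (snd c q - ?x) < e"
    proof -
      have "K * norm (snd c q - ?x) \<le> K * r"
        using q K by (intro mult_left_mono) (auto simp: dist_norm norm_minus_commute)
      also have "\<dots> < (K + 1) * r" using r by simp
      also have "\<dots> \<le> e" using r(4) K by (simp add: field_simps)
      finally show ?thesis .
    qed
    moreover have "chart_inv c ?x = p" "chart_inv c (snd c q) = q"
      using chart_inv_chart[OF c(1)] c q by auto
    ultimately show "d p q < ennreal e"
      using e by (metis (no_types, lifting) ennreal_lessI le_less_trans)
  qed
qed

section \<open>The weighted measure\<close>

abbreviation m where "m \<equiv> measure (weighted_measure X \<A> g f)"

lemma borel_sets_subset: "A \<in> borel_sets X \<Longrightarrow> A \<subseteq> topspace X"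
  unfolding borel_sets_def by (rule sigma_sets_into_sp) (auto dest: openin_subset)

lemma openin_borel_sets: "openin X U \<Longrightarrow> U \<in> borel_sets X"
  unfolding borel_sets_def by (rule sigma_sets.Basic) simp

lemma sets_weighted_measure: "sets (weighted_measure X \<A> g f) = borel_sets X"
  and space_weighted_measure: "space (weighted_measure X \<A> g f) = topspace X"
proof -
  have sub: "borel_sets X \<subseteq> Pow (topspace X)"
    using borel_sets_subset by blast
  have "{U. openin X U} \<subseteq> Pow (topspace X)"
    using openin_subset by blast
  then have "sigma_sets (topspace X) (borel_sets X) = borel_sets X"
    unfolding borel_sets_def by (rule sigma_sets_sigma_sets_eq)
  then show "sets (weighted_measure X \<A> g f) = borel_sets X"
    unfolding weighted_measure_def riemannian_volume_def
    by (simp add: sets_measure_of[OF sub])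
  show "space (weighted_measure X \<A> g f) = topspace X"
    unfolding weighted_measure_def riemannian_volume_def
    by (simp add: space_measure_of[OF sub])
qed

text \<open>A non-integrable function has integral 0, so the normalisation forces integrability of the
  weight. The same hypothesis rules out the case in which the set function that defines the volume
  fails to be countably additive, where the volume would be the zero measure.\<close>

lemma emeasure_weighted_topspace: "emeasure (weighted_measure X \<A> g f) (topspace X) = 1"
proof -
  let ?V = "riemannian_volume X \<A> g"
  have int: "integrable ?V (\<lambda>x. exp (- f x))"
  proof (rule ccontr)
    assume "\<not> ?thesis"
    then have "(\<integral>x. exp (- f x) \<partial>?V) = 0" by (rule not_integrable_integral_eq)
    with weight_normalized show False by simp
  qed
  have space: "space ?V = topspace X"
    using space_weighted_measure by (simp add: weighted_measure_def)
  have [measurable]: "(\<lambda>x. exp (- f x)) \<in> borel_measurable ?V"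
    using int by (rule borel_measurable_integrable)
  have "emeasure (weighted_measure X \<A> g f) (space ?V) =
      (\<integral>\<^sup>+x. ennreal (exp (- f x)) * indicator (space ?V) x \<partial>?V)"
    unfolding weighted_measure_def by (rule emeasure_density) measurable
  also have "\<dots> = (\<integral>\<^sup>+x. ennreal (exp (- f x)) \<partial>?V)"
    by (intro nn_integral_cong) simp
  also have "\<dots> = ennreal (\<integral>x. exp (- f x) \<partial>?V)"
    by (rule nn_integral_eq_integral[OF int]) simp
  finally show ?thesis by (simp add: weight_normalized space)
qed

lemma finite_weighted_measure: "finite_measure (weighted_measure X \<A> g f)"
  by (rule finite_measureI) (simp add: space_weighted_measure emeasure_weighted_topspace)

lemma weighted_measure_topspace: "m (topspace X) = 1"
  by (simp add: measure_def emeasure_weighted_topspace)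

lemma weighted_measure_mono: "B \<in> borel_sets X \<Longrightarrow> A \<subseteq> B \<Longrightarrow> m A \<le> m B"
  using finite_measure.finite_measure_mono[OF finite_weighted_measure]
  by (simp add: sets_weighted_measure)

section \<open>Neighbourhoods\<close>

text \<open>The points at finite distance from \<open>x\<close> form an open set with open complement, because nearby
  points are at finite distance from each other.\<close>

lemma riemannian_dist_finite:
  assumes x: "x \<in> topspace X" and y: "y \<in> topspace X"
  shows "d x y < top"
proof -
  define T where "T = {z \<in> topspace X. d x z < top}"
  have T_sub: "T \<subseteq> topspace X" by (auto simp: T_def)
  have step: "w \<in> T" if "z \<in> T" "w \<in> topspace X" "d z w < ennreal 1" for z w
  proof -
    have "d x w \<le> d x z + d z w" by (rule riemannian_dist_triangle)
    also have "\<dots> < top"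
      using that less_trans[OF that(3) ennreal_less_top] by (simp add: T_def)
    finally show ?thesis using that(2) by (simp add: T_def)
  qed
  have "openin X T"
  proof (subst openin_subopen, intro ballI)
    fix z assume z: "z \<in> T"
    then have "z \<in> topspace X" using T_sub by (rule subsetD[rotated])
    from riemannian_dist_small_nearby[OF this zero_less_one]
    obtain V where V: "openin X V" "z \<in> V" "\<And>q. q \<in> V \<Longrightarrow> d z q < ennreal 1" by blast
    have "V \<subseteq> T"
    proof
      fix q assume "q \<in> V"
      then show "q \<in> T" using openin_subset[OF V(1)] by (intro step[OF z] V(3)) auto
    qed
    with V(1,2) show "\<exists>V. openin X V \<and> z \<in> V \<and> V \<subseteq> T" by blast
  qed
  moreover have "openin X (topspace X - T)"
  proof (subst openin_subopen, intro ballI)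
    fix z assume z: "z \<in> topspace X - T"
    then have "z \<in> topspace X" by (rule DiffD1)
    from riemannian_dist_small_nearby[OF this zero_less_one]
    obtain V where V: "openin X V" "z \<in> V" "\<And>q. q \<in> V \<Longrightarrow> d z q < ennreal 1" by blast
    have "V \<subseteq> topspace X - T"
    proof
      fix q assume q: "q \<in> V"
      have "d q z < ennreal 1" unfolding riemannian_dist_commute[of q z] by (rule V(3)[OF q])
      then have "q \<notin> T" using step[of q z] z by blast
      then show "q \<in> topspace X - T" using openin_subset[OF V(1)] q by blast
    qed
    with V(1,2) show "\<exists>V. openin X V \<and> z \<in> V \<and> V \<subseteq> topspace X - T" by blast
  qed
  ultimately have "openin X T \<and> closedin X T"
    unfolding closedin_def using T_sub by (intro conjI)
  then have "T = {} \<or> T = topspace X"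
    by (rule connected[unfolded connected_space_clopen_in, rule_format])
  moreover have "x \<in> T" using x riemannian_dist_refl by (simp add: T_def)
  ultimately show ?thesis using y by (auto simp: T_def)
qed

lemma openin_open_nbhd: "openin X (open_nbhd X \<A> g r A)"
proof (subst openin_subopen, intro ballI)
  fix x assume "x \<in> open_nbhd X \<A> g r A"
  then obtain a where x: "x \<in> topspace X" and a: "a \<in> A" "d a x < ennreal r"
    by (auto simp: open_nbhd_def)
  have fin: "d a x < top" using a(2) by (rule less_trans) simp
  define e where "e = r - enn2real (d a x)"
  have dax: "d a x = ennreal (enn2real (d a x))" using fin by simp
  have e: "0 < e"
  proof -
    have "ennreal (enn2real (d a x)) < ennreal r" using a(2) dax by simp
    then show ?thesis by (simp add: e_def ennreal_less_iff)
  qed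
  obtain V where V: "openin X V" "x \<in> V" "\<And>q. q \<in> V \<Longrightarrow> d x q < ennreal e"
    using riemannian_dist_small_nearby[OF x e] by blast
  have "V \<subseteq> open_nbhd X \<A> g r A"
  proof
    fix q assume q: "q \<in> V"
    have "d a q \<le> d a x + d x q" by (rule riemannian_dist_triangle)
    also have "\<dots> < d a x + ennreal e" using V(3)[OF q] fin by simp
    also have "\<dots> = ennreal (enn2real (d a x)) + ennreal e" using dax by simp
    also have "\<dots> = ennreal r"
      using e by (subst ennreal_plus[symmetric]) (auto simp: e_def)
    finally show "q \<in> open_nbhd X \<A> g r A"
      using a(1) q openin_subset[OF V(1)] by (auto simp: open_nbhd_def)
  qed
  with V show "\<exists>V. openin X V \<and> x \<in> V \<and> V \<subseteq> open_nbhd X \<A> g r A" by blast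
qed

text \<open>The neighbourhoods \<open>open_nbhd X \<A> g r A\<close> for \<open>r > 0\<close>, extended to \<open>r = 0\<close> by \<open>A\<close> itself
  (the open neighbourhood of radius 0 is empty). The volume as a function of \<open>r\<close> then starts at the
  value \<open>m A\<close>, and its lower right derivative at every \<open>r \<ge> 0\<close> bounds the boundary measure.\<close>

definition thickening :: "'a set \<Rightarrow> real \<Rightarrow> 'a set" where
  "thickening A r = (if r = 0 then A else open_nbhd X \<A> g r A)"

lemma thickening_borel: "A \<in> borel_sets X \<Longrightarrow> thickening A r \<in> borel_sets X"
  unfolding thickening_def using openin_borel_sets[OF openin_open_nbhd] by simp

lemma subset_thickening:
  assumes "A \<subseteq> topspace X" "0 \<le> r"
  shows "A \<subseteq> thickening A r"
proof
  fix a assume "a \<in> A"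
  moreover have "d a a = 0" using \<open>a \<in> A\<close> assms(1) by (intro riemannian_dist_refl) auto
  ultimately show "a \<in> thickening A r"
    using assms by (auto simp: thickening_def open_nbhd_def intro!: bexI[of _ a])
qed

lemma thickening_near:
  assumes "A \<subseteq> topspace X" "0 \<le> r" "x \<in> thickening A r"
  obtains a where "a \<in> A" "d a x \<le> ennreal r"
proof (cases "r = 0")
  case True
  then have "x \<in> A" "d x x = 0"
    using assms by (auto simp: thickening_def intro!: riemannian_dist_refl)
  with True that show thesis by simp
next
  case False
  with assms that show thesis by (auto simp: thickening_def open_nbhd_def dest: less_imp_le)
qed

text \<open>This inclusion compares the boundary measure of a thickening with the derivative of the volume
  of thickenings.\<close>

lemma open_nbhd_thickening:
  assumes A: "A \<subseteq> topspace X" and "0 \<le> r" "0 < s"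
  shows "open_nbhd X \<A> g s (thickening A r) \<subseteq> thickening A (r + s)"
proof
  fix x assume "x \<in> open_nbhd X \<A> g s (thickening A r)"
  then obtain y where x: "x \<in> topspace X" and y: "y \<in> thickening A r" "d y x < ennreal s"
    by (auto simp: open_nbhd_def)
  obtain a where a: "a \<in> A" "d a y \<le> ennreal r"
    using thickening_near[OF A \<open>0 \<le> r\<close> y(1)] .
  have "d a x \<le> d a y + d y x" by (rule riemannian_dist_triangle)
  also have "\<dots> \<le> ennreal r + d y x" using a(2) by (rule add_right_mono)
  also have "\<dots> < ennreal r + ennreal s" using y(2) by simp
  also have "\<dots> = ennreal (r + s)" using assms by simp
  finally show "x \<in> thickening A (r + s)"
    using assms a(1) x by (auto simp: thickening_def open_nbhd_def)
qed

lemma thickening_mono: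
  assumes A: "A \<subseteq> topspace X" and "0 \<le> r" "r \<le> s"
  shows "thickening A r \<subseteq> thickening A s"
proof (cases "r = 0")
  case True
  then have "thickening A r = A" by (simp add: thickening_def)
  then show ?thesis using subset_thickening[OF A, of s] assms by simp
next
  case False
  then have r: "0 < r" "0 < s" using assms by simp_all
  have "ennreal r \<le> ennreal s" using assms by (intro ennreal_leI)
  then show ?thesis
    using r by (fastforce simp: thickening_def open_nbhd_def intro: less_le_trans)
qed

lemma thickening_disjoint:
  assumes "A \<subseteq> topspace X" "B \<subseteq> topspace X" "0 \<le> r" "0 \<le> s"
    and far: "\<And>a b. a \<in> A \<Longrightarrow> b \<in> B \<Longrightarrow> ennreal (r + s) < d a b"
  shows "thickening A r \<inter> thickening B s = {}"
proof (rule ccontr)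
  assume "\<not> ?thesis"
  then obtain x where x: "x \<in> thickening A r" "x \<in> thickening B s" by blast
  obtain a where a: "a \<in> A" "d a x \<le> ennreal r"
    using thickening_near[OF assms(1,3) x(1)] .
  obtain b where b: "b \<in> B" "d b x \<le> ennreal s"
    using thickening_near[OF assms(2,4) x(2)] .
  have "d a b \<le> d a x + d x b" by (rule riemannian_dist_triangle)
  also have "\<dots> \<le> ennreal r + ennreal s"
    using a b riemannian_dist_commute[of x b] by (intro add_mono) simp_all
  also have "\<dots> = ennreal (r + s)" using assms by simp
  finally show False using far[OF a(1) b(1)] by simp
qed

text \<open>The logarithm of the volume increases by at most \<open>ln (T / m A)\<close> over \<open>[0, R]\<close>, which bounds
  its average rate of growth. The factor \<open>e\<close> raises the rate in the conclusion strictly above that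
  average, as \<open>slow_growth_point\<close> requires.\<close>

lemma thickening_small_boundary:
  assumes A: "A \<in> borel_sets X" "0 < m A" and R: "0 < R" and T: "m (thickening A R) \<le> T"
  obtains r where "0 \<le> r" "r < R"
    "boundary_measure X \<A> g f (thickening A r) \<le> ereal (ln (exp 1 * T / m A) / R * m (thickening A r))"
proof -
  define \<phi> where "\<phi> r = m (thickening A r)" for r
  have sub: "A \<subseteq> topspace X" using A by (intro borel_sets_subset)
  have \<phi>_mono: "\<phi> r \<le> \<phi> s" if "0 \<le> r" "r \<le> s" for r s
    unfolding \<phi>_def using that A thickening_mono[OF sub that]
    by (intro weighted_measure_mono thickening_borel)
  have \<phi>0: "\<phi> 0 = m A" by (simp add: \<phi>_def thickening_def)
  have pos: "0 < \<phi> R" using \<phi>_mono[of 0 R] R A \<phi>0 by simp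
  then have "0 < T" using T by (simp add: \<phi>_def)
  have "\<phi> R / \<phi> 0 \<le> T / m A"
    using T A(2) unfolding \<phi>0 by (intro divide_right_mono) (simp_all add: \<phi>_def)
  also have "\<dots> < exp 1 * T / m A"
    using \<open>0 < T\<close> A(2) by (intro divide_strict_right_mono) simp_all
  finally have "ln (\<phi> R / \<phi> 0) < ln (exp 1 * T / m A)"
    using pos A(2) \<phi>0 by (subst ln_less_cancel_iff) (auto intro: less_trans[rotated])
  then have "ln (\<phi> R / \<phi> 0) / R < ln (exp 1 * T / m A) / R"
    using R by (rule divide_strict_right_mono)
  from slow_growth_point[of \<phi>, OF \<phi>_mono _ R this]
  obtain r where r: "0 \<le> r" "r < R"
    "Liminf (at_right 0) (\<lambda>s. ereal ((\<phi> (r + s) - \<phi> r) / s)) \<le> ereal (ln (exp 1 * T / m A) / R * \<phi> r)"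
    using A(2) \<phi>0 by auto
  have "boundary_measure X \<A> g f (thickening A r) \<le> Liminf (at_right 0) (\<lambda>s. ereal ((\<phi> (r + s) - \<phi> r) / s))"
    unfolding boundary_measure_def Let_def
  proof (rule Liminf_mono)
    have "\<forall>\<^sub>F s in at_right (0::real). 0 < s" by (rule eventually_at_right_less)
    then show "\<forall>\<^sub>F s in at_right 0.
        ereal ((m (open_nbhd X \<A> g s (thickening A r)) - m (thickening A r)) / s)
        \<le> ereal ((\<phi> (r + s) - \<phi> r) / s)"
    proof eventually_elim
      case (elim s)
      have "m (open_nbhd X \<A> g s (thickening A r)) \<le> \<phi> (r + s)"
        unfolding \<phi>_def using A(1) open_nbhd_thickening[OF sub r(1) elim]
        by (intro weighted_measure_mono thickening_borel)
      then have "(m (open_nbhd X \<A> g s (thickening A r)) - m (thickening A r)) / s \<le> (\<phi> (r + s) - \<phi> r) / s"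
        using elim by (intro divide_right_mono) (simp_all add: \<phi>_def)
      then show ?case by simp
    qed
  qed
  also note r(3)
  finally show thesis using that r(1,2) by (simp add: \<phi>_def)
qed

section \<open>The isoperimetric bound\<close>

lemma separation_le_dist:
  assumes "\<alpha> \<in> {1..k}" "a \<in> A \<alpha>"
  shows "\<lbrakk>\<beta> \<in> {1..k}; \<alpha> \<noteq> \<beta>; b \<in> A \<beta>\<rbrakk> \<Longrightarrow> separation X \<A> g k A \<le> d a b"
    and "b \<in> manifold_boundary \<A> \<Longrightarrow> separation X \<A> g k A \<le> d a b"
proof -
  have dist: "set_dist X \<A> g B C \<le> d a b" if "a \<in> B" "b \<in> C" for B C
    unfolding set_dist_def using that by (intro INF_lower2[of a] INF_lower)
  show "separation X \<A> g k A \<le> d a b" if "\<beta> \<in> {1..k}" "\<alpha> \<noteq> \<beta>" "b \<in> A \<beta>"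
    unfolding separation_def using assms that
    by (intro min.coboundedI1 INF_lower2[of \<alpha>] INF_lower2[of \<beta>] dist) auto
  show "separation X \<A> g k A \<le> d a b" if "b \<in> manifold_boundary \<A>"
    unfolding separation_def using assms that
    by (intro min.coboundedI2 INF_lower2[of \<alpha>] dist) auto
qed

lemma boundary_subset: "manifold_boundary \<A> \<subseteq> topspace X"
  using atlas unfolding manifold_boundary_def smooth_atlas_def by auto

text \<open>This is where \<open>1 - (\<Sum>\<beta> \<noteq> \<alpha>. m (A \<beta>))\<close> comes from: it is the volume left to a set that is
  disjoint from the others.\<close>

lemma measure_disjoint_from_rest:
  assumes I: "finite I" "\<And>\<beta>. \<beta> \<in> I \<Longrightarrow> A \<beta> \<in> borel_sets X" "disjoint_family_on A I"
    and B: "B \<in> borel_sets X" "\<And>\<beta>. \<beta> \<in> I \<Longrightarrow> B \<inter> A \<beta> = {}"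
  shows "m B \<le> 1 - (\<Sum>\<beta>\<in>I. m (A \<beta>))"
proof -
  let ?M = "weighted_measure X \<A> g f"
  have sets: "A ` I \<subseteq> sets ?M" using I(2) by (auto simp: sets_weighted_measure)
  then have U: "(\<Union>\<beta>\<in>I. A \<beta>) \<in> sets ?M" using I(1) by (intro sets.finite_UN) auto
  have "B \<subseteq> topspace X - (\<Union>\<beta>\<in>I. A \<beta>)"
    using B borel_sets_subset by blast
  then have "m B \<le> m (topspace X - (\<Union>\<beta>\<in>I. A \<beta>))"
    using U sets.compl_sets[OF U]
    by (intro weighted_measure_mono) (simp_all add: sets_weighted_measure space_weighted_measure)
  also have "\<dots> = 1 - m (\<Union>\<beta>\<in>I. A \<beta>)"
    using finite_measure.finite_measure_compl[OF finite_weighted_measure U]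
    by (simp add: space_weighted_measure weighted_measure_topspace)
  also have "m (\<Union>\<beta>\<in>I. A \<beta>) = (\<Sum>\<beta>\<in>I. m (A \<beta>))"
    by (rule finite_measure.finite_measure_finite_Union[OF finite_weighted_measure I(1) sets I(3)])
  finally show ?thesis .
qed

text \<open>The radii \<open>r \<alpha>\<close> are chosen one set at a time. All of them lie below half the separation, so
  any such choice yields disjoint sets in the interior, and the maximum of the quotients is bounded
  by the maximum of the individual bounds.\<close>

lemma dirichlet_isoperimetric_constant_le:
  assumes k: "1 \<le> k" and A: "\<And>\<alpha>. \<alpha> \<in> {1..k} \<Longrightarrow> A \<alpha> \<in> borel_sets X"
  shows "dirichlet_isoperimetric_constant X \<A> g f k \<le> separation_bound X \<A> g f k A"
proof (cases "separation X \<A> g k A = 0 \<or> (\<exists>\<alpha>\<in>{1..k}. m (A \<alpha>) = 0)")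
  case True
  then show ?thesis by (simp add: separation_bound_def Let_def)
next
  case False
  let ?D = "separation X \<A> g k A"
  have mpos: "0 < m (A \<alpha>)" if "\<alpha> \<in> {1..k}" for \<alpha>
    using False that by (auto simp: less_le)
  have D0: "?D \<noteq> 0" using False by simp
  have sub: "A \<alpha> \<subseteq> topspace X" if "\<alpha> \<in> {1..k}" for \<alpha>
    using A[OF that] by (rule borel_sets_subset)
  have one: "1 \<in> {1..k}" using k by simp
  \<comment> \<open>The separation is finite, so that its conversion to a real number does not yield 0.\<close>
  have "A 1 \<noteq> {}" using mpos[OF one] by auto
  then obtain a b where ab: "a \<in> A 1" "b \<in> manifold_boundary \<A>"
    using boundary_nonempty by blast
  have "?D \<le> d a b" using one ab by (rule separation_le_dist(2))
  also have "\<dots> < top"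
    using ab sub[OF one] boundary_subset by (intro riemannian_dist_finite) auto
  finally have "?D < top" .
  define R where "R = enn2real ?D / 2"
  have D: "?D = ennreal (2 * R)" using \<open>?D < top\<close> by (simp add: R_def)
  have R: "0 < R"
  proof (rule ccontr)
    assume "\<not> 0 < R"
    then have "?D = 0" using D by (simp add: ennreal_neg)
    with D0 show False by simp
  qed
  have far: "ennreal t < d a b"
    if "t < 2 * R" "\<alpha> \<in> {1..k}" "\<beta> \<in> {1..k}" "\<alpha> \<noteq> \<beta>" "a \<in> A \<alpha>" "b \<in> A \<beta>" for t \<alpha> \<beta> a b
  proof -
    have "ennreal t < ?D" unfolding D using that(1) R by (intro ennreal_lessI) auto
    also have "\<dots> \<le> d a b" using that by (intro separation_le_dist(1)[of \<alpha> _ _ _ \<beta>])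
    finally show ?thesis .
  qed
  have far_boundary: "ennreal t < d a b"
    if "t < 2 * R" "\<alpha> \<in> {1..k}" "a \<in> A \<alpha>" "b \<in> manifold_boundary \<A>" for t \<alpha> a b
  proof -
    have "ennreal t < ?D" unfolding D using that(1) R by (intro ennreal_lessI) auto
    also have "\<dots> \<le> d a b" using that by (intro separation_le_dist(2)[of \<alpha>])
    finally show ?thesis .
  qed
  have disj: "thickening (A \<alpha>) r \<inter> thickening (A \<beta>) s = {}"
    if "\<alpha> \<in> {1..k}" "\<beta> \<in> {1..k}" "\<alpha> \<noteq> \<beta>" "0 \<le> r" "0 \<le> s" "r + s < 2 * R" for \<alpha> \<beta> r s
    using sub[OF that(1)] sub[OF that(2)] that(4,5) far[OF that(6,1,2,3)]
    by (rule thickening_disjoint)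
  define T where "T \<alpha> = 1 - (\<Sum>\<beta>\<in>{1..k} - {\<alpha>}. m (A \<beta>))" for \<alpha>
  define c where "c \<alpha> = ln (exp 1 * T \<alpha> / m (A \<alpha>))" for \<alpha>
  have thick0: "thickening (A \<beta>) 0 = A \<beta>" for \<beta> by (simp add: thickening_def)
  have "\<exists>r. 0 \<le> r \<and> r < R \<and> boundary_measure X \<A> g f (thickening (A \<alpha>) r)
      \<le> ereal (c \<alpha> / R * m (thickening (A \<alpha>) r))" if \<alpha>: "\<alpha> \<in> {1..k}" for \<alpha>
  proof -
    have "m (thickening (A \<alpha>) R) \<le> T \<alpha>"
      unfolding T_def
    proof (rule measure_disjoint_from_rest)
      show "disjoint_family_on A ({1..k} - {\<alpha>})"
        unfolding disjoint_family_on_def using disj[of _ _ 0 0] R by (simp add: thick0)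
      show "thickening (A \<alpha>) R \<inter> A \<beta> = {}" if "\<beta> \<in> {1..k} - {\<alpha>}" for \<beta>
        using disj[of \<alpha> \<beta> R 0] \<alpha> that R by (simp add: thick0)
    qed (use A \<alpha> thickening_borel in auto)
    from thickening_small_boundary[OF A[OF \<alpha>] mpos[OF \<alpha>] R this]
    show ?thesis unfolding c_def by blast
  qed
  then obtain r where r: "\<And>\<alpha>. \<alpha> \<in> {1..k} \<Longrightarrow> 0 \<le> r \<alpha>" "\<And>\<alpha>. \<alpha> \<in> {1..k} \<Longrightarrow> r \<alpha> < R"
    "\<And>\<alpha>. \<alpha> \<in> {1..k} \<Longrightarrow> boundary_measure X \<A> g f (thickening (A \<alpha>) (r \<alpha>))
      \<le> ereal (c \<alpha> / R * m (thickening (A \<alpha>) (r \<alpha>)))"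
    by metis
  define C where "C \<alpha> = thickening (A \<alpha>) (r \<alpha>)" for \<alpha>
  have C_borel: "C \<alpha> \<in> borel_sets X" if "\<alpha> \<in> {1..k}" for \<alpha>
    unfolding C_def using A[OF that] by (rule thickening_borel)
  have C_pos: "0 < m (C \<alpha>)" if "\<alpha> \<in> {1..k}" for \<alpha>
    using mpos[OF that] weighted_measure_mono[OF C_borel[OF that], of "A \<alpha>"]
      subset_thickening[OF sub[OF that] r(1)[OF that]] by (simp add: C_def)
  have C_int: "C \<alpha> \<subseteq> manifold_interior X \<A>" if "\<alpha> \<in> {1..k}" for \<alpha>
  proof -
    have "thickening (A \<alpha>) (r \<alpha>) \<inter> thickening (manifold_boundary \<A>) 0 = {}"
    proof (rule thickening_disjoint[OF sub[OF that] boundary_subset r(1)[OF that] order_refl])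
      have "r \<alpha> + 0 < 2 * R" using r(2)[OF that] R by simp
      then show "ennreal (r \<alpha> + 0) < d a b" if "a \<in> A \<alpha>" "b \<in> manifold_boundary \<A>" for a b
        using \<open>\<alpha> \<in> {1..k}\<close> that by (rule far_boundary)
    qed
    then show ?thesis
      using borel_sets_subset[OF C_borel[OF that]]
      unfolding manifold_interior_def C_def by (auto simp: thickening_def[of "manifold_boundary \<A>"])
  qed
  have "disjoint_family_on C {1..k}"
    unfolding disjoint_family_on_def C_def
  proof (intro ballI impI)
    fix \<alpha> \<beta> assume "\<alpha> \<in> {1..k}" "\<beta> \<in> {1..k}" "\<alpha> \<noteq> \<beta>"
    then show "thickening (A \<alpha>) (r \<alpha>) \<inter> thickening (A \<beta>) (r \<beta>) = {}"
      using r(1)[of \<alpha>] r(1)[of \<beta>] r(2)[of \<alpha>] r(2)[of \<beta>] by (intro disj) auto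
  qed
  then have "dirichlet_isoperimetric_constant X \<A> g f k
      \<le> (MAX \<alpha>\<in>{1..k}. boundary_measure X \<A> g f (C \<alpha>) / ereal (m (C \<alpha>)))"
    unfolding dirichlet_isoperimetric_constant_def Let_def
    using C_borel C_int C_pos by (intro INF_lower) auto
  also have "\<dots> \<le> ereal (1 / R * (MAX \<alpha>\<in>{1..k}. c \<alpha>))"
  proof (rule Max.boundedI)
    fix q assume "q \<in> (\<lambda>\<alpha>. boundary_measure X \<A> g f (C \<alpha>) / ereal (m (C \<alpha>))) ` {1..k}"
    then obtain \<alpha> where \<alpha>: "\<alpha> \<in> {1..k}" "q = boundary_measure X \<A> g f (C \<alpha>) / ereal (m (C \<alpha>))"
      by blast
    have "boundary_measure X \<A> g f (C \<alpha>) \<le> ereal (m (C \<alpha>)) * ereal (c \<alpha> / R)"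
      using r(3)[OF \<alpha>(1)] by (simp add: C_def mult.commute)
    then have "q \<le> ereal (c \<alpha> / R)"
      unfolding \<alpha>(2) using C_pos[OF \<alpha>(1)] by (subst ereal_divide_le_pos) auto
    also have "c \<alpha> \<le> (MAX \<alpha>\<in>{1..k}. c \<alpha>)" using \<alpha>(1) by (intro Max_ge) auto
    then have "ereal (c \<alpha> / R) \<le> ereal (1 / R * (MAX \<alpha>\<in>{1..k}. c \<alpha>))"
      using R by (simp add: divide_right_mono)
    finally show "q \<le> ereal (1 / R * (MAX \<alpha>\<in>{1..k}. c \<alpha>))" .
  qed (use one in auto)
  also have "\<dots> = separation_bound X \<A> g f k A"
    using False by (simp add: separation_bound_def Let_def R_def c_def T_def)
  finally show ?thesis .
qed

end

theorem theorem5p8: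
  fixes X :: "'a topology"
    and \<A> :: "('a, 'n::finite) chart set"
    and g :: "('a, 'n) metric_components"
    and f :: "'a \<Rightarrow> real"
    and k :: nat
    and A :: "nat \<Rightarrow> 'a set"
  assumes "compact_weighted_riemannian_manifold X \<A> g f"
    and "1 \<le> k"
    and "\<And>\<alpha>. \<alpha> \<in> {1..k} \<Longrightarrow> A \<alpha> \<in> borel_sets X"
  shows "dirichlet_isoperimetric_constant X \<A> g f k \<le> separation_bound X \<A> g f k A"
proof -
  interpret compact_weighted_riemannian_manifold X \<A> g f by fact
  show ?thesis using assms(2,3) by (rule dirichlet_isoperimetric_constant_le)
qed

end
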